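(* For every no-signalling box $\vec p$, $$r_{\mathbb{D}}(\vec p)=r_{\mathcal{Q}}(\vec p)=\inf_{O\rightarrow\vec p}\ \min_{\rho\in\mathbb{D}}D(O,\rho)=\inf_{O\rightarrow\vec p}\frac{\|O\|_1-1}{2},$$ where the infima run over pseudo-states $O$ of arbitrary finite local dimensions with $O\rightarrow\vec p$ and $\mathbb{D}$ denotes density operators on the same space as $O$.
   Context: A box $\vec p$ is a collection $p(a,b|x,y)\ge0$ over fixed finite alphabets with $\sum_{a,b}p(a,b|x,y)=1$; it is no-signalling if Alice's marginal $\sum_bp(a,b|x,y)$ is independent of $y$ and Bob's marginal $\sum_ap(a,b|x,y)$ independent of $x$. $\mathcal{Q}$: boxes of the form $\mathrm{Tr}(M_{a|x}\otimes N_{b|y}\rho)$ with $\rho$ a density operator on a finite-dimensional bipartite space and local POVMs. A pseudo-state is a Hermitian unit-trace operator on a finite-dimensional $\mathcal{H}_A\otimes\mathcal{H}_B$; $O\rightarrow\vec p$ means $p(a,b|x,y)=\mathrm{Tr}(M_{a|x}\otimes N_{b|y}O)$ for some local POVMs. Robustness w.r.t. a set $S$: $r_S(v):=\inf\{t\ge0:\exists w\in S,\ (v+tw)/(1+t)\in S\}$; $r_{\mathcal{Q}}(\vec p)$ is the robustness w.r.t. $\mathcal{Q}$, $r_{\mathbb{D}}(O)$ the robustness of a pseudo-state w.r.t. density operators, and $r_{\mathbb{D}}(\vec p):=\inf_{O\rightarrow\vec p}r_{\mathbb{D}}(O)$. $\|\cdot\|_1$ is the trace norm and $D(X,Y)=\tfrac12\|X-Y\|_1$.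 *)

theory Defs
  imports Complex_Main "Jordan_Normal_Form.Schur_Decomposition"
begin

definition trace :: "complex mat \<Rightarrow> complex" where
  "trace A = (\<Sum>i<dim_row A. A $$ (i, i))"

definition hermitian_op :: "nat \<Rightarrow> complex mat \<Rightarrow> bool" where
  "hermitian_op d A \<longleftrightarrow> A \<in> carrier_mat d d \<and> mat_adjoint A = A"

definition psd_op :: "nat \<Rightarrow> complex mat \<Rightarrow> bool" where
  "psd_op d A \<longleftrightarrow> hermitian_op d A \<and>
     (\<forall>v \<in> carrier_vec d. 0 \<le> Re (conjugate v \<bullet> (A *\<^sub>v v)))"

definition kron :: "complex mat \<Rightarrow> complex mat \<Rightarrow> complex mat" where
  "kron A B = mat (dim_row A * dim_row B) (dim_col A * dim_col B)
     (\<lambda>(i, j). A $$ (i div dim_row B, j div dim_col B) * B $$ (i mod dim_row B, j mod dim_col B))"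

definition pseudo_state :: "nat \<Rightarrow> nat \<Rightarrow> complex mat \<Rightarrow> bool" where
  "pseudo_state dA dB Om \<longleftrightarrow> hermitian_op (dA * dB) Om \<and> trace Om = 1"

definition density_op :: "nat \<Rightarrow> complex mat \<Rightarrow> bool" where
  "density_op d \<rho> \<longleftrightarrow> psd_op d \<rho> \<and> trace \<rho> = 1"

definition povm :: "nat \<Rightarrow> ('a::finite \<Rightarrow> 'x \<Rightarrow> complex mat) \<Rightarrow> bool" where
  "povm d M \<longleftrightarrow> (\<forall>a x. psd_op d (M a x)) \<and>
     (\<forall>x. mat d d (\<lambda>ij. \<Sum>a\<in>UNIV. M a x $$ ij) = 1\<^sub>m d)"

definition mat_sqrt :: "nat \<Rightarrow> complex mat \<Rightarrow> complex mat" where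
  "mat_sqrt d A = (THE S. psd_op d S \<and> S * S = A)"

definition trace_norm :: "nat \<Rightarrow> complex mat \<Rightarrow> real" where
  "trace_norm d X = Re (trace (mat_sqrt d (mat_adjoint X * X)))"

definition trace_dist :: "nat \<Rightarrow> complex mat \<Rightarrow> complex mat \<Rightarrow> real" where
  "trace_dist d X Y = trace_norm d (X - Y) / 2"

type_synonym ('a, 'b, 'x, 'y) box = "'a \<Rightarrow> 'b \<Rightarrow> 'x \<Rightarrow> 'y \<Rightarrow> real"

text \<open>p a b x y stands for p(a,b|x,y).\<close>
definition is_box :: "('a::finite, 'b::finite, 'x::finite, 'y::finite) box \<Rightarrow> bool" where
  "is_box p \<longleftrightarrow> (\<forall>a b x y. 0 \<le> p a b x y) \<and> (\<forall>x y. (\<Sum>a\<in>UNIV. \<Sum>b\<in>UNIV. p a b x y) = 1)"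

definition no_signalling :: "('a::finite, 'b::finite, 'x::finite, 'y::finite) box \<Rightarrow> bool" where
  "no_signalling p \<longleftrightarrow> is_box p \<and>
     (\<forall>a x y y'. (\<Sum>b\<in>UNIV. p a b x y) = (\<Sum>b\<in>UNIV. p a b x y')) \<and>
     (\<forall>b x x' y. (\<Sum>a\<in>UNIV. p a b x y) = (\<Sum>a\<in>UNIV. p a b x' y))"

definition realizes :: "nat \<Rightarrow> nat \<Rightarrow> complex mat \<Rightarrow> ('a::finite, 'b::finite, 'x::finite, 'y::finite) box \<Rightarrow> bool" where
  "realizes dA dB Om p \<longleftrightarrow> (\<exists>(M :: 'a \<Rightarrow> 'x \<Rightarrow> complex mat) (N :: 'b \<Rightarrow> 'y \<Rightarrow> complex mat).
     povm dA M \<and> povm dB N \<and>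
     (\<forall>a b x y. complex_of_real (p a b x y) = trace (kron (M a x) (N b y) * Om)))"

definition quantum_boxes :: "('a::finite, 'b::finite, 'x::finite, 'y::finite) box set" where
  "quantum_boxes = {p. \<exists>dA dB \<rho>. density_op (dA * dB) \<rho> \<and> realizes dA dB \<rho> p}"

definition box_mix :: "('a, 'b, 'x, 'y) box \<Rightarrow> real \<Rightarrow> ('a, 'b, 'x, 'y) box \<Rightarrow> ('a, 'b, 'x, 'y) box" where
  "box_mix v t w = (\<lambda>a b x y. (v a b x y + t * w a b x y) / (1 + t))"

definition rob_Q :: "('a::finite, 'b::finite, 'x::finite, 'y::finite) box \<Rightarrow> real" where
  "rob_Q p = Inf {t. 0 \<le> t \<and> (\<exists>w \<in> quantum_boxes. box_mix p t w \<in> quantum_boxes)}"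

definition rob_D_op :: "nat \<Rightarrow> complex mat \<Rightarrow> real" where
  "rob_D_op d Om = Inf {t. 0 \<le> t \<and> (\<exists>\<sigma>. density_op d \<sigma> \<and>
       density_op d ((1 / (1 + complex_of_real t)) \<cdot>\<^sub>m (Om + complex_of_real t \<cdot>\<^sub>m \<sigma>)))}"

definition rob_D_box :: "('a::finite, 'b::finite, 'x::finite, 'y::finite) box \<Rightarrow> real" where
  "rob_D_box p = Inf {rob_D_op (dA * dB) Om | dA dB Om. pseudo_state dA dB Om \<and> realizes dA dB Om p}"

end

theory Submission
  imports Defs "Jordan_Normal_Form.Spectral_Radius"
begin

text \<open>
  Diagonalizing a pseudo-state as \<open>O = P - N\<close> with \<open>P\<close> and \<open>N\<close> positive semidefinite and orthogonal,
  \<open>Tr N = (\<parallel>O\<parallel>\<^sub>1 - 1) / 2\<close>, and every \<open>S \<ge> 0\<close> with \<open>O + S \<ge> 0\<close> has trace at least \<open>Tr N\<close>. This one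
  minimality statement gives both the robustness of \<open>O\<close> (take \<open>S = t \<sigma>\<close>) and its distance to
  the density operators (take \<open>S\<close> to be the negative part of \<open>O - \<rho>\<close>).

  A decomposition of \<open>O\<close> by density operators yields one of the box by measuring. Conversely, if
  \<open>p = (1 + t) q\<^sub>1 - t q\<^sub>2\<close> with quantum \<open>q\<^sub>1\<close>, \<open>q\<^sub>2\<close> realized by \<open>\<rho>\<^sub>1\<close>, \<open>\<rho>\<^sub>2\<close>, then
  \<open>(1 + t) \<rho>\<^sub>1 - t \<rho>\<^sub>2\<close>, with the two states embedded in orthogonal blocks of the direct sums of the
  local spaces and measured by block-diagonal POVMs, is a pseudo-state realizing \<open>p\<close>.
\<close>

section \<open>Adjoints and the spectral theorem\<close>

lemma mat_adjoint_dim [simp]: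
  "dim_row (mat_adjoint A) = dim_col A" "dim_col (mat_adjoint A) = dim_row A"
  by (auto simp: mat_adjoint_def)

lemma mat_adjoint_carrier [simp]:
  "A \<in> carrier_mat m n \<Longrightarrow> mat_adjoint A \<in> carrier_mat n m"
  by (intro carrier_matI) auto

lemma mat_adjoint_index [simp]:
  "i < dim_col A \<Longrightarrow> j < dim_row A \<Longrightarrow> mat_adjoint A $$ (i, j) = conjugate (A $$ (j, i))"
  by (simp add: mat_adjoint_def mat_of_rows_def)

lemma mat_adjoint_adjoint [simp]: "mat_adjoint (mat_adjoint A) = A"
  by (intro eq_matI) auto

lemma mat_adjoint_mult:
  fixes A B :: "complex mat"
  assumes "A \<in> carrier_mat m n" "B \<in> carrier_mat n k"
  shows "mat_adjoint (A * B) = mat_adjoint B * mat_adjoint A"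
  using assms
  by (intro eq_matI) (auto simp: scalar_prod_def sum_distrib_left intro!: sum.cong)

lemma mat_adjoint_add:
  fixes A B :: "complex mat"
  assumes "A \<in> carrier_mat m n" "B \<in> carrier_mat m n"
  shows "mat_adjoint (A + B) = mat_adjoint A + mat_adjoint B"
  using assms by (intro eq_matI) auto

lemma mat_adjoint_minus:
  fixes A B :: "complex mat"
  assumes "A \<in> carrier_mat m n" "B \<in> carrier_mat m n"
  shows "mat_adjoint (A - B) = mat_adjoint A - mat_adjoint B"
  using assms by (intro eq_matI) auto

lemma mat_adjoint_smult:
  "mat_adjoint (c \<cdot>\<^sub>m A) = cnj c \<cdot>\<^sub>m mat_adjoint A" for A :: "complex mat"
  by (intro eq_matI) auto

lemma mat_adjoint_one [simp]: "mat_adjoint (1\<^sub>m n :: complex mat) = 1\<^sub>m n"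
  by (intro eq_matI) auto

lemma mat_adjoint_diag:
  "mat_adjoint (mat_diag n (\<lambda>i. complex_of_real (l i))) = mat_diag n (\<lambda>i. complex_of_real (l i))"
  by (intro eq_matI) (auto simp: mat_diag_def)

section \<open>Isometries and congruences\<close>

lemma unitary_right_inverse:
  fixes U :: "complex mat"
  assumes "U \<in> carrier_mat n n" "mat_adjoint U * U = 1\<^sub>m n"
  shows "U * mat_adjoint U = 1\<^sub>m n"
  using assms mat_mult_left_right_inverse[of "mat_adjoint U" n U] by simp

text \<open>Plain associativity. It merges successive changes of basis, and it also makes cross
  terms between orthogonal blocks vanish, where \<open>V * U\<close> is zero.\<close>

lemma congruence_compose:
  fixes A U V :: "complex mat"
  assumes "A \<in> carrier_mat n n" "U \<in> carrier_mat m n" "V \<in> carrier_mat k m"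
  shows "V * (U * A * mat_adjoint U) * mat_adjoint V = (V * U) * A * mat_adjoint (V * U)"
proof -
  have "V * (U * A * mat_adjoint U) * mat_adjoint V = V * (U * A) * mat_adjoint U * mat_adjoint V"
    using assms by (subst assoc_mult_mat[of _ k m _ n _ m]) auto
  also have "\<dots> = V * U * A * mat_adjoint U * mat_adjoint V"
    using assms by (subst assoc_mult_mat[of _ k m _ n _ n]) auto
  also have "\<dots> = V * U * A * (mat_adjoint U * mat_adjoint V)"
    using assms by (subst assoc_mult_mat[of _ k n _ m _ k]) auto
  also have "mat_adjoint U * mat_adjoint V = mat_adjoint (V * U)"
    using assms by (simp add: mat_adjoint_mult[of V k m U n])
  finally show ?thesis .
qed

lemma isometry_mult:
  fixes U V :: "complex mat"
  assumes V: "V \<in> carrier_mat k m" and U: "U \<in> carrier_mat m n"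
    and VV: "mat_adjoint V * V = 1\<^sub>m m" and UU: "mat_adjoint U * U = 1\<^sub>m n"
  shows "mat_adjoint (V * U) * (V * U) = 1\<^sub>m n"
proof -
  have "mat_adjoint (V * U) * (V * U) = mat_adjoint U * mat_adjoint V * (V * U)"
    using V U by (simp add: mat_adjoint_mult[of V k m U n])
  also have "\<dots> = mat_adjoint U * (mat_adjoint V * (V * U))"
    using V U by (intro assoc_mult_mat[of _ n m _ k _ n]) auto
  also have "mat_adjoint V * (V * U) = mat_adjoint V * V * U"
    using V U by (intro assoc_mult_mat[symmetric, of _ m k _ m _ n]) auto
  finally show ?thesis using VV UU U by simp
qed

text \<open>The instance \<open>V = mat_adjoint U\<close> of \<open>congruence_compose\<close>.
  \<open>U\<close> may be rectangular, so eigenbases and inclusions of a block into a larger space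
  are treated alike.\<close>

lemma congruence_cancel:
  fixes A U :: "complex mat"
  assumes "A \<in> carrier_mat n n" "U \<in> carrier_mat m n" "mat_adjoint U * U = 1\<^sub>m n"
  shows "mat_adjoint U * (U * A * mat_adjoint U) * U = A"
  using congruence_compose[of A n U m "mat_adjoint U" n] assms by simp

lemma hermitian_congruence:
  assumes "hermitian_op n A" "U \<in> carrier_mat m n"
  shows "hermitian_op m (U * A * mat_adjoint U)"
proof -
  have A: "A \<in> carrier_mat n n" "mat_adjoint A = A"
    using assms by (auto simp: hermitian_op_def)
  have "mat_adjoint (U * A * mat_adjoint U) = U * mat_adjoint (U * A)"
    using assms(2) A by (subst mat_adjoint_mult[of _ m n _ m]) auto
  also have "\<dots> = U * (A * mat_adjoint U)"
    using assms(2) A by (subst mat_adjoint_mult[of _ m n _ n]) auto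
  also have "\<dots> = U * A * mat_adjoint U"
    using assms(2) A by (intro assoc_mult_mat[symmetric]) auto
  finally show ?thesis
    using assms(2) A by (auto simp: hermitian_op_def)
qed

section \<open>Unitary diagonalization of Hermitian matrices\<close>

text \<open>Complete \<open>v\<close> to a basis and apply Gram-Schmidt, which keeps the first
  vector; after normalization the vectors are the columns of a unitary.\<close>

lemma unitary_extension:
  assumes v: "(v :: complex vec) \<in> carrier_vec n" and v0: "v \<noteq> 0\<^sub>v n" and n: "n \<noteq> 0"
  obtains W c where "W \<in> carrier_mat n n" "mat_adjoint W * W = 1\<^sub>m n" "col W 0 = c \<cdot>\<^sub>v v"
proof -
  interpret cof_vec_space n "TYPE(complex)" .
  define b where "b = basis_completion v"
  define ws where "ws = gram_schmidt n b"
  note bc = basis_completion[OF v v0, folded b_def]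
  have "length b = n" "hd b = v" using bc by auto
  then obtain vs where bv: "b = v # vs" using n by (cases b) auto
  have ws: "set ws \<subseteq> carrier_vec n" "corthogonal ws" "length ws = n"
    using gram_schmidt_result[OF bc(2,4,5) refl, folded ws_def] bc(6) by auto
  have hdws: "ws ! 0 = v"
    using gram_schmidt_hd[OF v, of vs, folded bv] ws(3) n
    by (simp add: ws_def[symmetric] hd_conv_nth[of ws] flip: length_greater_0_conv)
  \<comment> \<open>The vectors \<open>ws ! i\<close> are orthogonal but of arbitrary length;
    \<open>r i\<close> is the length by which column \<open>i\<close> of \<open>W\<close> is
    rescaled.\<close>
  define r where "r i = sqrt (Re (ws ! i \<bullet>c ws ! i))" for i
  define W where "W = mat n n (\<lambda>(i, j). (1 / complex_of_real (r j)) * (ws ! j) $ i)"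
  have car: "ws ! i \<in> carrier_vec n" if "i < n" for i using ws that by auto
  have rr: "complex_of_real (r i) * complex_of_real (r i) = ws ! i \<bullet>c ws ! i" "r i \<noteq> 0"
    if i: "i < n" for i
  proof -
    \<comment> \<open>\<open>corthogonal\<close> includes that no vector is orthogonal to itself,
      and the order on complex numbers makes \<open>ge\<close> say that the square is real.\<close>
    have "ws ! i \<bullet>c ws ! i \<noteq> 0" using corthogonalD[OF ws(2), of i i] i ws(3) by auto
    moreover have ge: "ws ! i \<bullet>c ws ! i \<ge> 0" by (rule conjugate_square_ge_0_vec)
    ultimately have *: "Re (ws ! i \<bullet>c ws ! i) > 0" "Im (ws ! i \<bullet>c ws ! i) = 0"
      by (auto simp: less_eq_complex_def complex_eq_iff)
    then show "r i \<noteq> 0" by (simp add: r_def)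
    have "complex_of_real (r i) * complex_of_real (r i) = complex_of_real (Re (ws ! i \<bullet>c ws ! i))"
      using * by (simp add: r_def flip: of_real_mult)
    also have "\<dots> = ws ! i \<bullet>c ws ! i" using * by (simp add: complex_eq_iff)
    finally show "complex_of_real (r i) * complex_of_real (r i) = ws ! i \<bullet>c ws ! i" .
  qed
  have W: "W \<in> carrier_mat n n" by (simp add: W_def)
  have "mat_adjoint W * W = 1\<^sub>m n"
  proof (intro eq_matI)
    fix i j assume "i < dim_row (1\<^sub>m n :: complex mat)" "j < dim_col (1\<^sub>m n :: complex mat)"
    then have ij: "i < n" "j < n" by auto
    have "(mat_adjoint W * W) $$ (i, j) =
        (1 / complex_of_real (r i)) * (1 / complex_of_real (r j)) * (ws ! j \<bullet>c ws ! i)"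
      using ij W car[OF ij(1)] car[OF ij(2)]
      by (auto simp: scalar_prod_def W_def sum_distrib_left intro!: sum.cong)
    also have "\<dots> = 1\<^sub>m n $$ (i, j)"
    proof (cases "i = j")
      case True
      then show ?thesis using ij rr(2)[OF ij(2)] by (simp flip: rr(1)[OF ij(2)])
    next
      case False
      then have "ws ! j \<bullet>c ws ! i = 0" using corthogonalD[OF ws(2), of j i] ij ws(3) by simp
      then show ?thesis using ij False by simp
    qed
    finally show "(mat_adjoint W * W) $$ (i, j) = 1\<^sub>m n $$ (i, j)" .
  qed (use W in auto)
  moreover have "col W 0 = (1 / complex_of_real (r 0)) \<cdot>\<^sub>v v"
    using n v hdws by (intro eq_vecI) (auto simp: W_def)
  ultimately show ?thesis using W that by blast
qed

lemma mat_adjoint_four_block: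
  fixes A B C D :: "complex mat"
  assumes "A \<in> carrier_mat m m'" "B \<in> carrier_mat m n'" "C \<in> carrier_mat n m'" "D \<in> carrier_mat n n'"
  shows "mat_adjoint (four_block_mat A B C D) =
    four_block_mat (mat_adjoint A) (mat_adjoint C) (mat_adjoint B) (mat_adjoint D)"
  using assms by (intro eq_matI) auto

text \<open>Induction on the dimension. A unitary \<open>W\<close> whose first column is an
  eigenvector makes the first column of \<open>B\<close> a multiple of the first unit vector. As
  \<open>B\<close> is Hermitian, its first row has the same form, so \<open>B\<close> splits into a
  real 1 by 1 block and a Hermitian block of size \<open>n\<close>, to which the induction
  hypothesis applies.\<close>

theorem hermitian_spectral:
  assumes "hermitian_op n A"
  obtains U l where "U \<in> carrier_mat n n" "mat_adjoint U * U = 1\<^sub>m n"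
    "A = U * mat_diag n (\<lambda>i. complex_of_real (l i)) * mat_adjoint U"
proof -
  have "\<exists>U l. U \<in> carrier_mat n n \<and> mat_adjoint U * U = 1\<^sub>m n \<and>
      A = U * mat_diag n (\<lambda>i. complex_of_real (l i)) * mat_adjoint U"
    using assms
  proof (induction n arbitrary: A)
    case 0
    then show ?case
      by (intro exI[of _ "1\<^sub>m 0"] exI[of _ "\<lambda>_. 0"]) (auto simp: hermitian_op_def)
  next
    case (Suc n)
    have A: "A \<in> carrier_mat (Suc n) (Suc n)" using Suc.prems by (simp add: hermitian_op_def)
    obtain e where "eigenvalue A e"
      using spectrum_non_empty[OF A] by (auto simp: spectrum_def)
    then obtain v where v: "v \<in> carrier_vec (Suc n)" "v \<noteq> 0\<^sub>v (Suc n)" "A *\<^sub>v v = e \<cdot>\<^sub>v v"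
      using A by (auto simp: eigenvalue_def eigenvector_def)
    obtain W c where W: "W \<in> carrier_mat (Suc n) (Suc n)" "mat_adjoint W * W = 1\<^sub>m (Suc n)"
        and W0: "col W 0 = c \<cdot>\<^sub>v v"
      using unitary_extension[OF v(1,2)] by blast
    define B where "B = mat_adjoint W * A * W"
    have hB: "hermitian_op (Suc n) B"
      using hermitian_congruence[OF Suc.prems, of "mat_adjoint W" "Suc n"] W(1) by (simp add: B_def)
    have Bc: "B \<in> carrier_mat (Suc n) (Suc n)" using hB by (simp add: hermitian_op_def)
    have Bsym: "B $$ (i, j) = cnj (B $$ (j, i))" if "i < Suc n" "j < Suc n" for i j
      using hB Bc that mat_adjoint_index[of i B j] by (simp add: hermitian_op_def)
    have AB: "A = W * B * mat_adjoint W"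
      using congruence_cancel[of A "Suc n" "mat_adjoint W" "Suc n"] A W
        unitary_right_inverse[OF W] by (simp add: B_def)
    have cW: "col W 0 \<in> carrier_vec (Suc n)" using W(1) by (metis carrier_matD(1) col_dim)
    have "A *\<^sub>v col W 0 = e \<cdot>\<^sub>v col W 0"
      using v A by (simp add: W0 mult_mat_vec smult_smult_assoc mult.commute)
    have "col B 0 = (mat_adjoint W * A) *\<^sub>v col W 0"
      using W(1) A unfolding B_def by (intro col_mult2) auto
    also have "\<dots> = mat_adjoint W *\<^sub>v (A *\<^sub>v col W 0)"
      using W(1) A by (intro assoc_mult_mat_vec[OF _ _ cW]) auto
    also have "\<dots> = e \<cdot>\<^sub>v (mat_adjoint W *\<^sub>v col W 0)"
      using W(1) cW \<open>A *\<^sub>v col W 0 = e \<cdot>\<^sub>v col W 0\<close>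
      by (simp add: mult_mat_vec[of _ "Suc n" "Suc n"])
    also have "mat_adjoint W *\<^sub>v col W 0 = col (mat_adjoint W * W) 0"
      using W(1) by (intro col_mult2[symmetric]) auto
    finally have "col B 0 = e \<cdot>\<^sub>v unit_vec (Suc n) 0" using W(2) by simp
    then have B0: "B $$ (i, 0) = (if i = 0 then e else 0)" if "i < Suc n" for i
      using that Bc by (auto dest!: arg_cong[where f = "\<lambda>v. v $ i"])
    define B3 where "B3 = mat n n (\<lambda>(i, j). B $$ (Suc i, Suc j))"
    \<comment> \<open>The eigenvalue is a diagonal entry of a Hermitian matrix, hence real.\<close>
    have e: "e = complex_of_real (Re e)"
      using Bsym[of 0 0] B0[of 0] by (simp add: complex_eq_iff)
    have B0': "B $$ (0, i) = (if i = 0 then e else 0)" if "i < Suc n" for i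
      using Bsym[of 0 i] B0 that by (cases "i = 0") auto
    have "hermitian_op n B3"
      by (auto simp: hermitian_op_def B3_def Bsym[symmetric] intro!: eq_matI)
    then obtain U3 l3 where U3: "U3 \<in> carrier_mat n n" "mat_adjoint U3 * U3 = 1\<^sub>m n"
        "B3 = U3 * mat_diag n (\<lambda>i. complex_of_real (l3 i)) * mat_adjoint U3"
      using Suc.IH by blast
    \<comment> \<open>The split-off eigenvalue comes first, then those of the lower block;
      correspondingly \<open>U\<close> fixes the first coordinate and acts as \<open>U3\<close> on
      the others.\<close>
    define l where "l i = (case i of 0 \<Rightarrow> Re e | Suc k \<Rightarrow> l3 k)" for i
    define D3 where "D3 = mat_diag n (\<lambda>i. complex_of_real (l3 i))"
    define U where "U = four_block_mat (1\<^sub>m 1) (0\<^sub>m 1 n) (0\<^sub>m n 1) U3"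
    have U: "U \<in> carrier_mat (Suc n) (Suc n)"
      using U3(1) four_block_carrier_mat[of "1\<^sub>m 1" 1 1 U3 n n] by (simp add: U_def)
    have zero [simp]: "mat_adjoint (0\<^sub>m a b :: complex mat) = 0\<^sub>m b a" for a b
      by (intro eq_matI) auto
    have aU: "mat_adjoint U = four_block_mat (1\<^sub>m 1) (0\<^sub>m 1 n) (0\<^sub>m n 1) (mat_adjoint U3)"
      using U3(1) unfolding U_def by (subst mat_adjoint_four_block[of _ 1 1 _ n _ n]) auto
    have D3: "D3 \<in> carrier_mat n n" by (simp add: D3_def)
    have eB: "B = four_block_mat (e \<cdot>\<^sub>m 1\<^sub>m 1) (0\<^sub>m 1 n) (0\<^sub>m n 1) B3"
      using Bc by (intro eq_matI) (auto simp: B3_def B0 B0' less_Suc_eq_0_disj)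
    have eD: "mat_diag (Suc n) (\<lambda>i. complex_of_real (l i)) =
        four_block_mat (e \<cdot>\<^sub>m 1\<^sub>m 1) (0\<^sub>m 1 n) (0\<^sub>m n 1) D3"
      using e by (intro eq_matI) (auto simp: D3_def l_def mat_diag_def split: nat.splits)
    have UU: "mat_adjoint U * U = 1\<^sub>m (Suc n)"
      unfolding aU unfolding U_def using U3(1,2)
      by (subst mult_four_block_mat[of _ 1 1 _ n _ n _ _ 1 _ n]) (auto intro!: eq_matI)
    have UD: "U * mat_diag (Suc n) (\<lambda>i. complex_of_real (l i)) =
        four_block_mat (e \<cdot>\<^sub>m 1\<^sub>m 1) (0\<^sub>m 1 n) (0\<^sub>m n 1) (U3 * D3)"
      unfolding eD unfolding U_def using U3(1) D3
      by (subst mult_four_block_mat[of _ 1 1 _ n _ n _ _ 1 _ n]) simp_all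
    have "B = U * mat_diag (Suc n) (\<lambda>i. complex_of_real (l i)) * mat_adjoint U"
      unfolding aU eB U3(3) D3_def[symmetric] UD using U3(1) D3
      by (subst mult_four_block_mat[of _ 1 1 _ n _ n _ _ 1 _ n]) (simp_all add: mult_carrier_mat[of _ n n])
    then have "A = (W * U) * mat_diag (Suc n) (\<lambda>i. complex_of_real (l i)) * mat_adjoint (W * U)"
      using AB congruence_compose[OF mat_diag_dim U W(1)] by metis
    moreover have "mat_adjoint (W * U) * (W * U) = 1\<^sub>m (Suc n)"
      using isometry_mult[OF W(1) U W(2) UU] .
    moreover have "W * U \<in> carrier_mat (Suc n) (Suc n)"
      using W(1) U by simp
    ultimately show ?case by blast
  qed
  then show ?thesis using that by blast
qed

section \<open>Traces and positive semidefinite matrices\<close>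

lemma mult_square_carrier [simp]:
  "A \<in> carrier_mat n n \<Longrightarrow> B \<in> carrier_mat n n \<Longrightarrow> A * B \<in> carrier_mat n n"
  by (rule mult_carrier_mat)

lemma smult_smult_mat: "a \<cdot>\<^sub>m (b \<cdot>\<^sub>m A) = (a * b) \<cdot>\<^sub>m A" for A :: "'a :: semigroup_mult mat"
  by (intro eq_matI) (auto simp: mult.assoc)

lemma smult_one_mat [simp]: "1 \<cdot>\<^sub>m A = A" for A :: "'a :: monoid_mult mat"
  by (intro eq_matI) auto

lemma smult_mat_zero: "A \<in> carrier_mat m n \<Longrightarrow> 0 \<cdot>\<^sub>m A = 0\<^sub>m m n" for A :: "'a :: mult_zero mat"
  by (intro eq_matI) auto

lemma trace_mult_comm:
  assumes "A \<in> carrier_mat m n" "B \<in> carrier_mat n m"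
  shows "trace (A * B) = trace (B * A)"
proof -
  have "trace (A * B) = (\<Sum>i<m. \<Sum>j<n. A $$ (i, j) * B $$ (j, i))"
    using assms by (auto simp: trace_def scalar_prod_def lessThan_atLeast0 intro!: sum.cong)
  also have "\<dots> = (\<Sum>j<n. \<Sum>i<m. B $$ (j, i) * A $$ (i, j))"
    by (subst sum.swap) (simp add: mult.commute)
  also have "\<dots> = trace (B * A)"
    using assms by (auto simp: trace_def scalar_prod_def lessThan_atLeast0 intro!: sum.cong)
  finally show ?thesis .
qed

lemma trace_add:
  "A \<in> carrier_mat n n \<Longrightarrow> B \<in> carrier_mat n n \<Longrightarrow> trace (A + B) = trace A + trace B"
  by (auto simp: trace_def sum.distrib)

lemma trace_minus:
  "A \<in> carrier_mat n n \<Longrightarrow> B \<in> carrier_mat n n \<Longrightarrow> trace (A - B) = trace A - trace B"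
  by (auto simp: trace_def sum_subtractf)

lemma trace_smult: "A \<in> carrier_mat n n \<Longrightarrow> trace (c \<cdot>\<^sub>m A) = c * trace A"
  by (auto simp: trace_def sum_distrib_left)

lemma trace_diag: "trace (mat_diag n f) = (\<Sum>i<n. f i)"
  by (auto simp: trace_def mat_diag_def)

lemma trace_congruence:
  fixes A U :: "complex mat"
  assumes "A \<in> carrier_mat n n" "U \<in> carrier_mat m n" "mat_adjoint U * U = 1\<^sub>m n"
  shows "trace (U * A * mat_adjoint U) = trace A"
proof -
  have "trace (U * A * mat_adjoint U) = trace (mat_adjoint U * (U * A))"
    using assms by (intro trace_mult_comm) auto
  also have "mat_adjoint U * (U * A) = mat_adjoint U * U * A"
    using assms by (intro assoc_mult_mat[symmetric]) auto
  finally show ?thesis using assms by simp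
qed

lemma hermitian_op_carrier: "hermitian_op d A \<Longrightarrow> A \<in> carrier_mat d d"
  by (simp add: hermitian_op_def)

lemma psd_op_hermitian: "psd_op d A \<Longrightarrow> hermitian_op d A"
  by (simp add: psd_op_def)

lemma psd_op_carrier: "psd_op d A \<Longrightarrow> A \<in> carrier_mat d d"
  by (simp add: psd_op_def hermitian_op_def)

lemma hermitian_index_sym:
  assumes "hermitian_op d A" "i < d" "j < d"
  shows "cnj (A $$ (i, j)) = A $$ (j, i)"
proof -
  have "A \<in> carrier_mat d d" "mat_adjoint A = A" using assms by (auto simp: hermitian_op_def)
  then show ?thesis using mat_adjoint_index[of j A i] assms(2,3) by simp
qed

lemma Im_trace_hermitian:
  assumes "hermitian_op d A"
  shows "Im (trace A) = 0"
proof -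
  have "Im (A $$ (i, i)) = 0" if "i < d" for i
    using hermitian_index_sym[OF assms that that] by (simp add: complex_eq_iff)
  then show ?thesis using hermitian_op_carrier[OF assms] by (auto simp: trace_def)
qed

lemma hermitian_add:
  "hermitian_op d A \<Longrightarrow> hermitian_op d B \<Longrightarrow> hermitian_op d (A + B)"
  by (auto simp: hermitian_op_def mat_adjoint_add)

lemma hermitian_minus:
  "hermitian_op d A \<Longrightarrow> hermitian_op d B \<Longrightarrow> hermitian_op d (A - B)"
  by (auto simp: hermitian_op_def mat_adjoint_minus)

lemma hermitian_smult:
  "hermitian_op d A \<Longrightarrow> hermitian_op d (complex_of_real c \<cdot>\<^sub>m A)"
  by (auto simp: hermitian_op_def mat_adjoint_smult)

section \<open>Positive semidefinite matrices\<close>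

lemma adjoint_scalar_prod:
  fixes U :: "complex mat"
  assumes "U \<in> carrier_mat m n" "v \<in> carrier_vec m" "w \<in> carrier_vec n"
  shows "conjugate v \<bullet> (U *\<^sub>v w) = conjugate (mat_adjoint U *\<^sub>v v) \<bullet> w"
proof -
  have "conjugate v \<bullet> (U *\<^sub>v w) = (\<Sum>i<m. \<Sum>j<n. cnj (v $ i) * (U $$ (i, j) * w $ j))"
    using assms by (auto simp: scalar_prod_def sum_distrib_left lessThan_atLeast0 intro!: sum.cong)
  also have "\<dots> = (\<Sum>j<n. \<Sum>i<m. cnj (cnj (U $$ (i, j)) * v $ i) * w $ j)"
    by (subst sum.swap) (simp add: algebra_simps)
  also have "\<dots> = conjugate (mat_adjoint U *\<^sub>v v) \<bullet> w"
    using assms by (auto simp: scalar_prod_def sum_distrib_right lessThan_atLeast0 intro!: sum.cong)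
  finally show ?thesis .
qed

text \<open>The quadratic form of the congruence at \<open>v\<close> is that of \<open>A\<close> at
  \<open>mat_adjoint U *\<^sub>v v\<close>.\<close>

lemma psd_congruence:
  assumes "psd_op n A" "U \<in> carrier_mat m n"
  shows "psd_op m (U * A * mat_adjoint U)"
  unfolding psd_op_def
proof (intro conjI ballI)
  show "hermitian_op m (U * A * mat_adjoint U)"
    using assms by (intro hermitian_congruence psd_op_hermitian)
  fix v :: "complex vec" assume v: "v \<in> carrier_vec m"
  have A: "A \<in> carrier_mat n n" using assms(1) by (rule psd_op_carrier)
  define w where "w = mat_adjoint U *\<^sub>v v"
  have w: "w \<in> carrier_vec n"
    using v assms(2) by (auto simp: w_def intro!: mult_mat_vec_carrier[of _ n m])
  have "U * A * mat_adjoint U *\<^sub>v v = U *\<^sub>v (A *\<^sub>v w)"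
    using assms(2) A v
    by (simp add: w_def assoc_mult_mat_vec[of _ m n _ m] assoc_mult_mat_vec[of _ m n _ n]
        mult_carrier_mat[of _ m n] mult_mat_vec_carrier[of _ n m])
  then show "0 \<le> Re (conjugate v \<bullet> (U * A * mat_adjoint U *\<^sub>v v))"
    using assms w A v adjoint_scalar_prod[of U m n v "A *\<^sub>v w"]
    by (simp add: psd_op_def w_def)
qed

lemma psd_congruence_adjoint:
  assumes "psd_op n A" "U \<in> carrier_mat n m"
  shows "psd_op m (mat_adjoint U * A * U)"
  using psd_congruence[OF assms(1), of "mat_adjoint U" m] assms(2) by simp

lemma psd_add:
  assumes "psd_op d A" "psd_op d B"
  shows "psd_op d (A + B)"
  unfolding psd_op_def
proof (intro conjI ballI)
  show "hermitian_op d (A + B)" using assms by (intro hermitian_add psd_op_hermitian)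
  fix v :: "complex vec" assume v: "v \<in> carrier_vec d"
  have "A \<in> carrier_mat d d" "B \<in> carrier_mat d d" using assms psd_op_carrier by auto
  then have "conjugate v \<bullet> ((A + B) *\<^sub>v v) = conjugate v \<bullet> (A *\<^sub>v v) + conjugate v \<bullet> (B *\<^sub>v v)"
    using v by (simp add: add_mult_distrib_mat_vec[of _ d d] scalar_prod_add_distrib[of _ d])
  then show "0 \<le> Re (conjugate v \<bullet> ((A + B) *\<^sub>v v))"
    using assms v by (simp add: psd_op_def)
qed

lemma psd_smult:
  assumes "psd_op d A" "0 \<le> c"
  shows "psd_op d (complex_of_real c \<cdot>\<^sub>m A)"
  unfolding psd_op_def
proof (intro conjI ballI)
  show "hermitian_op d (complex_of_real c \<cdot>\<^sub>m A)"
    using assms by (intro hermitian_smult psd_op_hermitian)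
  fix v :: "complex vec" assume v: "v \<in> carrier_vec d"
  have A: "A \<in> carrier_mat d d" using assms psd_op_carrier by auto
  have "(complex_of_real c \<cdot>\<^sub>m A) *\<^sub>v v = complex_of_real c \<cdot>\<^sub>v (A *\<^sub>v v)"
    using A v by (intro eq_vecI) (auto simp: scalar_prod_def sum_distrib_left mult.assoc)
  then have "conjugate v \<bullet> ((complex_of_real c \<cdot>\<^sub>m A) *\<^sub>v v) = complex_of_real c * (conjugate v \<bullet> (A *\<^sub>v v))"
    using A v by simp
  then show "0 \<le> Re (conjugate v \<bullet> ((complex_of_real c \<cdot>\<^sub>m A) *\<^sub>v v))"
    using assms v by (simp add: psd_op_def)
qed

lemma psd_mat_diag:
  assumes "\<And>i. i < n \<Longrightarrow> 0 \<le> l i"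
  shows "psd_op n (mat_diag n (\<lambda>i. complex_of_real (l i)))"
  unfolding psd_op_def
proof (intro conjI ballI)
  let ?D = "mat_diag n (\<lambda>i. complex_of_real (l i))"
  show "hermitian_op n ?D" by (simp add: hermitian_op_def mat_adjoint_diag)
  fix v :: "complex vec" assume v: "v \<in> carrier_vec n"
  have "?D *\<^sub>v v = vec n (\<lambda>i. complex_of_real (l i) * v $ i)"
  proof (intro eq_vecI)
    fix i assume "i < dim_vec (vec n (\<lambda>i. complex_of_real (l i) * v $ i))"
    then have "i < n" by simp
    then show "(?D *\<^sub>v v) $ i = vec n (\<lambda>i. complex_of_real (l i) * v $ i) $ i"
      using v by (simp add: mat_diag_def scalar_prod_def if_distrib[of "\<lambda>x. x * _"] cong: if_cong)
  qed (simp add: mat_diag_def)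
  then have "conjugate v \<bullet> (?D *\<^sub>v v) = (\<Sum>i<n. complex_of_real (l i) * (cnj (v $ i) * v $ i))"
    using v by (auto simp: scalar_prod_def lessThan_atLeast0 algebra_simps intro!: sum.cong)
  also have "Re \<dots> = (\<Sum>i<n. l i * ((Re (v $ i))\<^sup>2 + (Im (v $ i))\<^sup>2))"
    by (simp add: power2_eq_square)
  also have "\<dots> \<ge> 0" using assms by (intro sum_nonneg) simp
  finally show "0 \<le> Re (conjugate v \<bullet> (?D *\<^sub>v v))" by simp
qed

text \<open>Evaluate the quadratic form at a unit vector. Applied after a change to an eigenbasis,
  this is how positivity turns into inequalities between eigenvalues below.\<close>

lemma psd_diagonal_nonneg:
  assumes "psd_op d A" "i < d"
  shows "0 \<le> Re (A $$ (i, i))"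
proof -
  have A: "A \<in> carrier_mat d d" using assms(1) by (rule psd_op_carrier)
  have "conjugate (unit_vec d i :: complex vec) = unit_vec d i"
    by (intro eq_vecI) (auto simp: unit_vec_def)
  then have "conjugate (unit_vec d i) \<bullet> (A *\<^sub>v unit_vec d i) = A $$ (i, i)"
    using A assms(2) by simp
  then show ?thesis using assms unfolding psd_op_def by (metis unit_vec_carrier)
qed

lemma psd_trace_nonneg:
  assumes "psd_op d A"
  shows "0 \<le> Re (trace A)"
  using assms psd_diagonal_nonneg[OF assms] psd_op_carrier[OF assms]
  by (auto simp: trace_def intro!: sum_nonneg)

section \<open>The trace norm of a Hermitian matrix\<close>

text \<open>Functional calculus in a fixed eigenbasis: for a fixed unitary \<open>U\<close>, sums
  and products act pointwise on \<open>l\<close>, so positive parts, negative parts and absolute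
  values are obtained by changing \<open>l\<close> alone.\<close>

definition unitary_diag :: "nat \<Rightarrow> complex mat \<Rightarrow> (nat \<Rightarrow> real) \<Rightarrow> complex mat" where
  "unitary_diag n U l = U * mat_diag n (\<lambda>i. complex_of_real (l i)) * mat_adjoint U"

lemma unitary_diag_add:
  assumes "U \<in> carrier_mat n n"
  shows "unitary_diag n U l + unitary_diag n U m = unitary_diag n U (\<lambda>i. l i + m i)"
proof -
  have "mat_diag n (\<lambda>i. complex_of_real (l i + m i)) =
      mat_diag n (\<lambda>i. complex_of_real (l i)) + mat_diag n (\<lambda>i. complex_of_real (m i))"
    by (intro eq_matI) (auto simp: mat_diag_def)
  then show ?thesis
    using assms
    by (simp add: unitary_diag_def mult_add_distrib_mat[of U n n _ n]
        add_mult_distrib_mat[of _ n n _ _ n] mult_carrier_mat[of U n n])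
qed

lemma unitary_diag_mult:
  assumes U: "U \<in> carrier_mat n n" "mat_adjoint U * U = 1\<^sub>m n"
  shows "unitary_diag n U l * unitary_diag n U m = unitary_diag n U (\<lambda>i. l i * m i)"
proof -
  define D where "D l = mat_diag n (\<lambda>i. complex_of_real (l i))" for l
  have D: "D l \<in> carrier_mat n n" for l by (simp add: D_def)
  have "U * D l * mat_adjoint U * (U * D m * mat_adjoint U) =
      U * D l * (mat_adjoint U * (U * D m * mat_adjoint U))"
    using U D by (intro assoc_mult_mat[of _ n n _ n _ n]) auto
  also have "mat_adjoint U * (U * D m * mat_adjoint U) = mat_adjoint U * (U * (D m * mat_adjoint U))"
    using U D by (subst assoc_mult_mat[of U n n _ n _ n]) auto
  also have "\<dots> = mat_adjoint U * U * (D m * mat_adjoint U)"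
    using U D by (intro assoc_mult_mat[symmetric, of _ n n _ n _ n]) auto
  also have "\<dots> = D m * mat_adjoint U"
    using U D left_mult_one_mat[of "D m * mat_adjoint U" n n] by simp
  also have "U * D l * (D m * mat_adjoint U) = U * D l * D m * mat_adjoint U"
    using U D by (intro assoc_mult_mat[symmetric, of _ n n _ n _ n]) auto
  also have "U * D l * D m = U * (D l * D m)"
    using U D by (intro assoc_mult_mat[of _ n n _ n _ n]) auto
  also have "D l * D m = D (\<lambda>i. l i * m i)" by (simp add: D_def)
  finally show ?thesis by (simp add: unitary_diag_def D_def)
qed

lemma psd_unitary_diag:
  assumes "U \<in> carrier_mat n n" "\<And>i. i < n \<Longrightarrow> 0 \<le> l i"
  shows "psd_op n (unitary_diag n U l)"
  unfolding unitary_diag_def using assms by (auto intro!: psd_congruence psd_mat_diag)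

lemma trace_unitary_diag:
  assumes "U \<in> carrier_mat n n" "mat_adjoint U * U = 1\<^sub>m n"
  shows "trace (unitary_diag n U l) = complex_of_real (\<Sum>i<n. l i)"
  unfolding unitary_diag_def using assms
  by (subst trace_congruence[of _ n _ n]) (auto simp: trace_diag)

lemma unitary_conjugation_mult:
  fixes A B U :: "complex mat"
  assumes A: "A \<in> carrier_mat n n" and B: "B \<in> carrier_mat n n"
    and U: "U \<in> carrier_mat n n" "mat_adjoint U * U = 1\<^sub>m n"
  shows "(mat_adjoint U * A * U) * (mat_adjoint U * B * U) = mat_adjoint U * (A * B) * U"
proof -
  have "(mat_adjoint U * A * U) * (mat_adjoint U * B * U) =
      mat_adjoint U * A * (U * (mat_adjoint U * B * U))"
    using A B U by (intro assoc_mult_mat[of _ n n _ n _ n]) auto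
  also have "U * (mat_adjoint U * B * U) = U * (mat_adjoint U * (B * U))"
    using A B U by (subst assoc_mult_mat[of _ n n _ n _ n]) auto
  also have "\<dots> = U * mat_adjoint U * (B * U)"
    using A B U by (intro assoc_mult_mat[symmetric, of _ n n _ n _ n]) auto
  also have "\<dots> = B * U"
    using unitary_right_inverse[OF U] left_mult_one_mat[OF mult_carrier_mat[OF B U(1)]] by simp
  also have "mat_adjoint U * A * (B * U) = mat_adjoint U * A * B * U"
    using A B U by (intro assoc_mult_mat[symmetric, of _ n n _ n _ n]) auto
  also have "mat_adjoint U * A * B = mat_adjoint U * (A * B)"
    using A B U by (intro assoc_mult_mat[of _ n n _ n _ n]) auto
  finally show ?thesis .
qed

text \<open>Work in an eigenbasis of \<open>S - T\<close>, where the difference is the diagonal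
  matrix \<open>D\<close>. Then \<open>S' * D + D * T' = S' * S' - T' * T' = 0\<close>, and its
  diagonal says that \<open>l i\<close> times the sum of the \<open>i\<close>-th diagonal entries of
  \<open>S'\<close> and \<open>T'\<close> is zero. These entries are nonnegative and their
  difference is \<open>l i\<close>, so \<open>l i = 0\<close>. This uniqueness gives the definite
  description in \<open>mat_sqrt\<close> its meaning.\<close>

lemma psd_sqrt_unique:
  assumes S: "psd_op n S" and T: "psd_op n T" and eq: "S * S = T * T"
  shows "S = T"
proof -
  have Sc: "S \<in> carrier_mat n n" and Tc: "T \<in> carrier_mat n n"
    using S T psd_op_carrier by auto
  obtain U l where U: "U \<in> carrier_mat n n" "mat_adjoint U * U = 1\<^sub>m n"
    and ST: "S - T = U * mat_diag n (\<lambda>i. complex_of_real (l i)) * mat_adjoint U"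
    using hermitian_spectral[OF hermitian_minus[OF S[THEN psd_op_hermitian] T[THEN psd_op_hermitian]]]
    by blast
  define D where "D = mat_diag n (\<lambda>i. complex_of_real (l i))"
  define S' where "S' = mat_adjoint U * S * U"
  define T' where "T' = mat_adjoint U * T * U"
  have S'c: "S' \<in> carrier_mat n n" and T'c: "T' \<in> carrier_mat n n" and Dc: "D \<in> carrier_mat n n"
    using Sc Tc U by (auto simp: S'_def T'_def D_def)
  have D: "D = S' - T'"
  proof -
    have "D = mat_adjoint U * (S - T) * U"
      unfolding ST D_def using U by (intro congruence_cancel[symmetric]) auto
    then show ?thesis
      using U(1) Sc Tc
      by (simp add: S'_def T'_def mult_minus_distrib_mat[of _ n n _ n] minus_mult_distrib_mat[of _ n n _ _ n])
  qed
  have sq: "S' * S' = T' * T'"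
    using unitary_conjugation_mult[OF Sc Sc U] unitary_conjugation_mult[OF Tc Tc U] eq
    by (simp add: S'_def T'_def)
  have "S' * D + D * T' = S' * S' - S' * T' + (S' * T' - T' * T')"
    unfolding D using S'c T'c
    by (simp add: mult_minus_distrib_mat[of _ n n _ n] minus_mult_distrib_mat[of _ n n _ _ n])
  also have "\<dots> = 0\<^sub>m n n"
    using S'c T'c unfolding sq by (intro eq_matI) auto
  finally have zero: "S' * D + D * T' = 0\<^sub>m n n" .
  have "l i = 0" if i: "i < n" for i
  proof -
    have "(S' * D + D * T') $$ (i, i) = complex_of_real (l i) * (S' $$ (i, i) + T' $$ (i, i))"
      unfolding D_def using i S'c T'c
      by (simp add: mat_diag_mult_left[of _ n n] mat_diag_mult_right[of _ n n] algebra_simps)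
    then have "complex_of_real (l i) * (S' $$ (i, i) + T' $$ (i, i)) = 0"
      using zero i by simp
    from arg_cong[OF this, of Re] have 1: "l i * (Re (S' $$ (i, i)) + Re (T' $$ (i, i))) = 0"
      by (simp del: mult_eq_0_iff)
    have "D $$ (i, i) = S' $$ (i, i) - T' $$ (i, i)" using D i S'c T'c by simp
    then have 2: "l i = Re (S' $$ (i, i)) - Re (T' $$ (i, i))"
      using i by (auto simp: D_def mat_diag_def dest!: arg_cong[where f = Re])
    have "0 \<le> Re (S' $$ (i, i))" "0 \<le> Re (T' $$ (i, i))"
      unfolding S'_def T'_def using i
      using psd_diagonal_nonneg[OF psd_congruence_adjoint[OF S U(1)]]
        psd_diagonal_nonneg[OF psd_congruence_adjoint[OF T U(1)]] by blast+
    with 1 2 show ?thesis by auto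
  qed
  then have "S - T = U * 0\<^sub>m n n * mat_adjoint U"
    unfolding ST
    by (intro arg_cong2[where f = "(*)"] refl eq_matI) (auto simp: mat_diag_def)
  then have "S - T = 0\<^sub>m n n" using U by simp
  moreover have "S = (S - T) + T" using Sc Tc by (intro eq_matI) auto
  ultimately show ?thesis using Tc by simp
qed

lemma mat_sqrt_eq:
  assumes "psd_op d S" "S * S = A"
  shows "mat_sqrt d A = S"
  unfolding mat_sqrt_def using assms psd_sqrt_unique by (intro the_equality) auto

text \<open>The matrix is Hermitian, so its adjoint times itself has eigenvalues
  \<open>l i * l i\<close>, and the positive root has eigenvalues
  \<open>\<bar>l i\<bar>\<close>.\<close>

lemma trace_norm_unitary_diag:
  assumes U: "U \<in> carrier_mat d d" "mat_adjoint U * U = 1\<^sub>m d"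
  shows "trace_norm d (unitary_diag d U l) = (\<Sum>i<d. \<bar>l i\<bar>)"
proof -
  have "hermitian_op d (unitary_diag d U l)"
    unfolding unitary_diag_def using U
    by (intro hermitian_congruence) (auto simp: hermitian_op_def mat_adjoint_diag)
  then have "mat_sqrt d (mat_adjoint (unitary_diag d U l) * unitary_diag d U l) =
      unitary_diag d U (\<lambda>i. \<bar>l i\<bar>)"
    using U by (intro mat_sqrt_eq psd_unitary_diag) (auto simp: unitary_diag_mult hermitian_op_def)
  then show ?thesis by (simp add: trace_norm_def trace_unitary_diag[OF U])
qed

section \<open>Robustness and trace distance of a pseudo-state\<close>

text \<open>In an eigenbasis of \<open>X\<close> the diagonal entries of \<open>X + S\<close> and \<open>S\<close> are nonnegative, so the
  diagonal entries of \<open>S\<close> dominate the negative parts of the eigenvalues of \<open>X\<close>.\<close>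

lemma hermitian_minimal_decomposition:
  assumes "hermitian_op d X"
  obtains P N where "psd_op d P" "psd_op d N" "X + N = P"
    "trace_norm d X = Re (trace P) + Re (trace N)"
    "\<And>S. psd_op d S \<Longrightarrow> psd_op d (X + S) \<Longrightarrow> Re (trace N) \<le> Re (trace S)"
proof -
  obtain U l where U: "U \<in> carrier_mat d d" "mat_adjoint U * U = 1\<^sub>m d"
    and X: "X = unitary_diag d U l"
    using hermitian_spectral[OF assms] unfolding unitary_diag_def by metis
  \<comment> \<open>The positive and negative spectral parts of \<open>X\<close>. They share its
    eigenbasis, so the identities for \<open>X + N\<close> and the trace norm are checked on each
    eigenvalue.\<close>
  define P where "P = unitary_diag d U (\<lambda>i. max 0 (l i))"
  define N where "N = unitary_diag d U (\<lambda>i. max 0 (- l i))"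
  have "psd_op d P" "psd_op d N"
    using U by (auto simp: P_def N_def intro!: psd_unitary_diag)
  moreover have "X + N = P"
    using U by (simp add: X P_def N_def unitary_diag_add max_def) (rule arg_cong[where f = "unitary_diag d U"], auto)
  moreover have "trace_norm d X = Re (trace P) + Re (trace N)"
  proof -
    have "\<bar>l i\<bar> = max 0 (l i) + max 0 (- l i)" for i by auto
    then show ?thesis
      unfolding P_def N_def X trace_norm_unitary_diag[OF U] trace_unitary_diag[OF U]
      by (simp only: sum.distrib Re_complex_of_real)
  qed
  moreover have "Re (trace N) \<le> Re (trace S)" if S: "psd_op d S" and XS: "psd_op d (X + S)" for S
  proof -
    have Sc: "S \<in> carrier_mat d d" using S by (rule psd_op_carrier)
    have Xc: "X \<in> carrier_mat d d" using assms by (rule hermitian_op_carrier)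
    define S' where "S' = mat_adjoint U * S * U"
    have S'c: "S' \<in> carrier_mat d d" using Sc U by (simp add: S'_def)
    have "mat_adjoint U * (X + S) * U = mat_adjoint U * X * U + S'"
      using Sc Xc U(1)
      by (simp add: S'_def mult_add_distrib_mat[of _ d d _ d] add_mult_distrib_mat[of _ d d _ _ d])
    also have "mat_adjoint U * X * U = mat_diag d (\<lambda>i. complex_of_real (l i))"
      unfolding X unitary_diag_def using U by (intro congruence_cancel) auto
    finally have "psd_op d (mat_diag d (\<lambda>i. complex_of_real (l i)) + S')"
      using psd_congruence_adjoint[OF XS U(1)] by simp
    then have "0 \<le> l i + Re (S' $$ (i, i))" if "i < d" for i
      using psd_diagonal_nonneg[of d _ i] that S'c by (fastforce simp: mat_diag_def)
    moreover have "0 \<le> Re (S' $$ (i, i))" if "i < d" for i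
      unfolding S'_def using that psd_congruence_adjoint[OF S U(1)] psd_diagonal_nonneg by blast
    ultimately have "(\<Sum>i<d. max 0 (- l i)) \<le> (\<Sum>i<d. Re (S' $$ (i, i)))"
      by (intro sum_mono) (smt (verit) lessThan_iff)
    also have "\<dots> = Re (trace S')" using S'c by (simp add: trace_def)
    also have "trace S' = trace S"
      unfolding S'_def using trace_congruence[of S d "mat_adjoint U" d] Sc U unitary_right_inverse[OF U]
      by simp
    finally show ?thesis by (simp add: N_def trace_unitary_diag[OF U])
  qed
  ultimately show ?thesis using that by blast
qed

text \<open>\<open>N\<close> is admissible as \<open>S\<close> in the minimality statement for
  \<open>P - N\<close>, so the spectral negative part has trace at most that of \<open>N\<close>.
  Both decompositions have the same difference of traces, so the positive parts compare in the same
  way.\<close>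

lemma trace_norm_le:
  assumes P: "psd_op d P" and N: "psd_op d N"
  shows "trace_norm d (P - N) \<le> Re (trace P) + Re (trace N)"
proof -
  have c: "P \<in> carrier_mat d d" "N \<in> carrier_mat d d" using P N psd_op_carrier by auto
  obtain P' N' where 1: "psd_op d P'" "psd_op d N'" "P - N + N' = P'"
    "trace_norm d (P - N) = Re (trace P') + Re (trace N')"
    "\<And>S. psd_op d S \<Longrightarrow> psd_op d (P - N + S) \<Longrightarrow> Re (trace N') \<le> Re (trace S)"
    using hermitian_minimal_decomposition[of d "P - N"] P N by (metis hermitian_minus psd_op_hermitian)
  have "P - N + N = P" using c by (intro eq_matI) auto
  then have "Re (trace N') \<le> Re (trace N)" using 1(5)[OF N] P by simp
  moreover have "trace P' = trace P - trace N + trace N'"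
    using c 1(2)[THEN psd_op_carrier] by (simp flip: 1(3) add: trace_add[of _ d] trace_minus[of _ d] minus_carrier_mat)
  ultimately show ?thesis using 1(4) by simp
qed

text \<open>Unit trace gives \<open>trace P = 1 + trace N\<close>, and the trace norm is the sum of
  both traces, so \<open>\<nu>\<close> is exactly the trace of the negative part.\<close>

lemma pseudo_state_decomposition:
  assumes O: "hermitian_op d Om" and tr: "trace Om = 1"
  defines "\<nu> \<equiv> (trace_norm d Om - 1) / 2"
  obtains P N where "psd_op d P" "psd_op d N" "Om + N = P" "0 \<le> \<nu>"
    "trace P = complex_of_real (1 + \<nu>)" "trace N = complex_of_real \<nu>"
    "\<And>S. psd_op d S \<Longrightarrow> psd_op d (Om + S) \<Longrightarrow> \<nu> \<le> Re (trace S)"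
proof -
  obtain P N where 1: "psd_op d P" "psd_op d N" "Om + N = P"
    "trace_norm d Om = Re (trace P) + Re (trace N)"
    "\<And>S. psd_op d S \<Longrightarrow> psd_op d (Om + S) \<Longrightarrow> Re (trace N) \<le> Re (trace S)"
    using hermitian_minimal_decomposition[OF O] by metis
  have "trace P = 1 + trace N"
    using hermitian_op_carrier[OF O] psd_op_carrier[OF 1(2)] tr
    by (simp flip: 1(3) add: trace_add[of _ d])
  then have "\<nu> = Re (trace N)" using 1(4) by (simp add: \<nu>_def)
  moreover have "Im (trace N) = 0" using 1(2) psd_op_hermitian Im_trace_hermitian by blast
  ultimately have "trace N = complex_of_real \<nu>" by (simp add: complex_eq_iff)
  then show ?thesis
    using that[OF 1(1-3)] 1(5) \<open>trace P = 1 + trace N\<close> psd_trace_nonneg[OF 1(2)] by simp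
qed

lemma density_scaled:
  assumes "psd_op d A" "trace A = complex_of_real c" "0 < c"
  shows "density_op d ((1 / complex_of_real c) \<cdot>\<^sub>m A)"
  using assms psd_smult[of d A "1 / c"]
  by (simp add: density_op_def trace_smult[OF psd_op_carrier])

text \<open>The eigenvalues are nonnegative and sum to zero. This covers \<open>\<nu> = 0\<close>,
  where the negative part cannot be normalized to a density operator.\<close>

lemma psd_trace_0:
  assumes "psd_op d A" "trace A = 0"
  shows "A = 0\<^sub>m d d"
proof -
  obtain U l where U: "U \<in> carrier_mat d d" "mat_adjoint U * U = 1\<^sub>m d"
    and A: "A = U * mat_diag d (\<lambda>i. complex_of_real (l i)) * mat_adjoint U"
    using hermitian_spectral[OF psd_op_hermitian[OF assms(1)]] by metis
  have "mat_adjoint U * A * U = mat_diag d (\<lambda>i. complex_of_real (l i))"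
    unfolding A using U by (intro congruence_cancel) auto
  then have "psd_op d (mat_diag d (\<lambda>i. complex_of_real (l i)))"
    using psd_congruence_adjoint[OF assms(1) U(1)] by simp
  then have "0 \<le> l i" if "i < d" for i
    using psd_diagonal_nonneg[of d _ i] that by (fastforce simp: mat_diag_def)
  moreover have "(\<Sum>i<d. l i) = 0"
    using assms(2) trace_unitary_diag[OF U, of l] by (simp add: unitary_diag_def A del: of_real_sum)
  ultimately have "l i = 0" if "i < d" for i
    using that sum_nonneg_eq_0_iff[of "{..<d}" l] by auto
  then have "A = U * 0\<^sub>m d d * mat_adjoint U"
    unfolding A by (intro arg_cong2[where f = "(*)"] refl eq_matI) (auto simp: mat_diag_def)
  then show ?thesis using U by simp
qed

text \<open>Membership in the set whose infimum is \<open>rob_D_op\<close>, named so that the lower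
  bound and its attainment can be stated separately.\<close>

definition robust_feasible :: "nat \<Rightarrow> complex mat \<Rightarrow> real \<Rightarrow> bool" where
  "robust_feasible d Om t \<longleftrightarrow> 0 \<le> t \<and> (\<exists>\<sigma>. density_op d \<sigma> \<and>
     density_op d ((1 / (1 + complex_of_real t)) \<cdot>\<^sub>m (Om + complex_of_real t \<cdot>\<^sub>m \<sigma>)))"

text \<open>Multiplying the mixture by \<open>1 + t\<close> shows that \<open>Om\<close> plus
  \<open>t\<close> times \<open>\<sigma>\<close> is positive, so the latter term, of trace
  \<open>t\<close>, is admissible in the minimality statement.\<close>

lemma robust_feasible_ge:
  assumes O: "hermitian_op d Om" "trace Om = 1" and t: "robust_feasible d Om t"
  shows "(trace_norm d Om - 1) / 2 \<le> t"
proof -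
  have 1: "\<And>S. psd_op d S \<Longrightarrow> psd_op d (Om + S) \<Longrightarrow> (trace_norm d Om - 1) / 2 \<le> Re (trace S)"
    using pseudo_state_decomposition[OF O] by metis
  obtain \<sigma> where t0: "0 \<le> t" and \<sigma>: "density_op d \<sigma>"
    and D: "density_op d ((1 / (1 + complex_of_real t)) \<cdot>\<^sub>m (Om + complex_of_real t \<cdot>\<^sub>m \<sigma>))"
    using t by (auto simp: robust_feasible_def)
  have \<sigma>c: "\<sigma> \<in> carrier_mat d d" using \<sigma> by (auto simp: density_op_def psd_op_carrier)
  have "psd_op d (complex_of_real t \<cdot>\<^sub>m \<sigma>)" using \<sigma> t0 by (simp add: density_op_def psd_smult)
  moreover have "psd_op d (complex_of_real (1 + t) \<cdot>\<^sub>m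
      ((1 / (1 + complex_of_real t)) \<cdot>\<^sub>m (Om + complex_of_real t \<cdot>\<^sub>m \<sigma>)))"
    using D t0 by (intro psd_smult) (auto simp: density_op_def)
  moreover have "complex_of_real (1 + t) \<cdot>\<^sub>m ((1 / (1 + complex_of_real t)) \<cdot>\<^sub>m (Om + complex_of_real t \<cdot>\<^sub>m \<sigma>))
      = Om + complex_of_real t \<cdot>\<^sub>m \<sigma>"
  proof -
    have "complex_of_real (1 + t) * (1 / (1 + complex_of_real t)) = 1"
      using t0 by (simp add: complex_eq_iff)
    then show ?thesis by (simp only: smult_smult_mat smult_one_mat)
  qed
  ultimately have "(trace_norm d Om - 1) / 2 \<le> Re (trace (complex_of_real t \<cdot>\<^sub>m \<sigma>))"
    using 1 by simp
  then show ?thesis using \<sigma> by (simp add: trace_smult[OF \<sigma>c] density_op_def)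
qed

text \<open>Take \<open>\<sigma> = N / \<nu>\<close>; the mixture is then
  \<open>P / (1 + \<nu>)\<close>.\<close>

lemma robust_feasible_attained:
  assumes O: "hermitian_op d Om" "trace Om = 1"
  shows "robust_feasible d Om ((trace_norm d Om - 1) / 2)"
proof -
  define \<nu> where "\<nu> = (trace_norm d Om - 1) / 2"
  obtain P N where 1: "psd_op d P" "psd_op d N" "Om + N = P" "0 \<le> \<nu>"
    "trace P = complex_of_real (1 + \<nu>)" "trace N = complex_of_real \<nu>"
    using pseudo_state_decomposition[OF O] unfolding \<nu>_def by metis
  have c: "N \<in> carrier_mat d d" "P \<in> carrier_mat d d" "Om \<in> carrier_mat d d"
    using 1 O psd_op_carrier hermitian_op_carrier by auto
  have dP: "density_op d ((1 / (1 + complex_of_real \<nu>)) \<cdot>\<^sub>m P)"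
    using density_scaled[OF 1(1,5)] 1(4) by simp
  obtain \<sigma> where "density_op d \<sigma>" "complex_of_real \<nu> \<cdot>\<^sub>m \<sigma> = N"
  proof (cases "\<nu> = 0")
    \<comment> \<open>Here \<open>N = 0\<close> and \<open>\<sigma>\<close> has weight zero, so any
      density operator serves; the normalized \<open>P\<close> is one at hand.\<close>
    case True
    then have "N = 0\<^sub>m d d" using 1 psd_trace_0 by simp
    then show ?thesis using that[of "(1 / (1 + complex_of_real \<nu>)) \<cdot>\<^sub>m P"] dP True c(2)
      by (simp add: smult_mat_zero)
  next
    case False
    then show ?thesis
      using that[of "(1 / complex_of_real \<nu>) \<cdot>\<^sub>m N"] density_scaled[OF 1(2,6)] 1(4) c
      by (simp add: smult_smult_mat)
  qed
  then show ?thesis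
    using 1 dP unfolding robust_feasible_def \<nu>_def[symmetric] by auto
qed

lemma rob_D_op_eq:
  assumes "hermitian_op d Om" "trace Om = 1"
  shows "rob_D_op d Om = (trace_norm d Om - 1) / 2"
  unfolding rob_D_op_def robust_feasible_def[symmetric]
  using robust_feasible_ge[OF assms] robust_feasible_attained[OF assms]
  by (intro cInf_eq_minimum) auto

text \<open>Let \<open>N'\<close> be the negative part of \<open>Om - \<rho>\<close>. Then
  \<open>Om + N' = P' + \<rho>\<close> is positive, so minimality bounds \<open>trace N'\<close>
  below by \<open>\<nu>\<close>; and since \<open>Om - \<rho>\<close> has trace zero, the distance
  equals \<open>trace N'\<close>. The bound is attained, so the infimum is a minimum.\<close>

lemma Inf_trace_dist_eq:
  assumes O: "hermitian_op d Om" "trace Om = 1"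
  shows "Inf {trace_dist d Om \<rho> | \<rho>. density_op d \<rho>} = (trace_norm d Om - 1) / 2"
proof -
  define \<nu> where "\<nu> = (trace_norm d Om - 1) / 2"
  obtain P N where 1: "psd_op d P" "psd_op d N" "Om + N = P" "0 \<le> \<nu>"
    "trace P = complex_of_real (1 + \<nu>)" "trace N = complex_of_real \<nu>"
    and min: "\<And>S. psd_op d S \<Longrightarrow> psd_op d (Om + S) \<Longrightarrow> \<nu> \<le> Re (trace S)"
    using pseudo_state_decomposition[OF O] unfolding \<nu>_def by metis
  have car: "N \<in> carrier_mat d d" "P \<in> carrier_mat d d" "Om \<in> carrier_mat d d"
    using 1 O psd_op_carrier hermitian_op_carrier by auto
  have ge: "\<nu> \<le> trace_dist d Om \<rho>" if \<rho>: "density_op d \<rho>" for \<rho>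
  proof -
    have \<rho>p: "psd_op d \<rho>" "\<rho> \<in> carrier_mat d d" "trace \<rho> = 1"
      using \<rho> by (auto simp: density_op_def psd_op_carrier)
    obtain P' N' where 2: "psd_op d P'" "psd_op d N'" "Om - \<rho> + N' = P'"
      "trace_norm d (Om - \<rho>) = Re (trace P') + Re (trace N')"
      using hermitian_minimal_decomposition[OF hermitian_minus[OF O(1) psd_op_hermitian[OF \<rho>p(1)]]]
      by metis
    have c': "N' \<in> carrier_mat d d" using 2 psd_op_carrier by auto
    have "Om + N' = Om - \<rho> + N' + \<rho>" using car c' \<rho>p(2) by (intro eq_matI) auto
    then have "psd_op d (Om + N')" using 2 \<rho>p psd_add by simp
    then have "\<nu> \<le> Re (trace N')" using 2 min by blast
    moreover have "trace P' = trace N'"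
      using car c' \<rho>p O(2) by (simp flip: 2(3) add: trace_add[of _ d] trace_minus[of _ d] minus_carrier_mat)
    ultimately show ?thesis using 2(4) by (simp add: trace_dist_def)
  qed
  \<comment> \<open>The minimizer is the normalized positive part of \<open>Om\<close>. As
    \<open>Om = P - N\<close>, the difference \<open>Om - \<rho>\<close> is \<open>c\<close> times
    \<open>P\<close> minus \<open>N\<close>, and both terms have trace \<open>\<nu>\<close>.\<close>
  define u where "u = 1 / complex_of_real (1 + \<nu>)"
  define \<rho> where "\<rho> = u \<cdot>\<^sub>m P"
  have \<rho>: "density_op d \<rho>" unfolding \<rho>_def u_def using 1 by (intro density_scaled) auto
  define c where "c = complex_of_real (\<nu> / (1 + \<nu>))"
  have "\<nu> / (1 + \<nu>) = 1 - 1 / (1 + \<nu>)" using 1(4) by (simp add: field_simps)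
  from arg_cong[OF this, of complex_of_real] have cu: "c = 1 - u" by (simp add: c_def u_def)
  have "Om - \<rho> = c \<cdot>\<^sub>m P - N"
  proof (intro eq_matI)
    fix i j assume "i < dim_row (c \<cdot>\<^sub>m P - N)"
      "j < dim_col (c \<cdot>\<^sub>m P - N)"
    then have ij: "i < d" "j < d" using car by auto
    have "P $$ (i, j) = Om $$ (i, j) + N $$ (i, j)" using car ij by (simp flip: 1(3))
    then show "(Om - \<rho>) $$ (i, j) = (c \<cdot>\<^sub>m P - N) $$ (i, j)"
      using car ij by (simp add: \<rho>_def cu algebra_simps)
  qed (use car in \<open>auto simp: \<rho>_def\<close>)
  moreover have "psd_op d (c \<cdot>\<^sub>m P)"
    unfolding c_def using 1 by (intro psd_smult) auto
  ultimately have "trace_norm d (Om - \<rho>) \<le> Re (trace (c \<cdot>\<^sub>m P)) + Re (trace N)"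
    using trace_norm_le 1(2) by metis
  also have "\<dots> = 2 * \<nu>"
  proof -
    have "\<nu> / (1 + \<nu>) * (1 + \<nu>) = \<nu>" using 1(4) by simp
    then show ?thesis
      unfolding trace_smult[OF car(2)] 1(5,6) c_def
      by (simp only: of_real_mult[symmetric] Re_complex_of_real)
  qed
  finally have "trace_dist d Om \<rho> \<le> \<nu>" by (simp add: trace_dist_def)
  then have "trace_dist d Om \<rho> = \<nu>" using ge[OF \<rho>] by simp
  then show ?thesis unfolding \<nu>_def[symmetric] using \<rho> ge by (intro cInf_eq_minimum) auto
qed

section \<open>Kronecker products\<close>

lemma kron_dim [simp]:
  "dim_row (kron A B) = dim_row A * dim_row B" "dim_col (kron A B) = dim_col A * dim_col B"
  by (auto simp: kron_def)

lemma kron_carrier [simp]: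
  "A \<in> carrier_mat m n \<Longrightarrow> B \<in> carrier_mat m' n' \<Longrightarrow> kron A B \<in> carrier_mat (m * m') (n * n')"
  by (intro carrier_matI) auto

lemma kron_index:
  "i < dim_row A * dim_row B \<Longrightarrow> j < dim_col A * dim_col B \<Longrightarrow>
   kron A B $$ (i, j) = A $$ (i div dim_row B, j div dim_col B) * B $$ (i mod dim_row B, j mod dim_col B)"
  by (simp add: kron_def)

lemma div_mod_less_mult:
  fixes i m n :: nat
  assumes "i < m * n"
  shows "i div n < m" "i mod n < n"
  using assms by (cases "n = 0"; simp add: less_mult_imp_div_less)+

text \<open>The row-major numbering of pairs that underlies \<open>kron\<close>, as a reindexing of
  sums.\<close>

lemma sum_div_mod:
  fixes f :: "nat \<Rightarrow> nat \<Rightarrow> 'a :: comm_monoid_add"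
  shows "(\<Sum>k<m * n. f (k div n) (k mod n)) = (\<Sum>i<m. \<Sum>j<n. f i j)"
proof -
  have "(\<Sum>i<m. \<Sum>j<n. f i j) = (\<Sum>(i, j)\<in>{..<m} \<times> {..<n}. f i j)"
    by (simp add: sum.cartesian_product)
  also have "\<dots> = (\<Sum>k<m * n. f (k div n) (k mod n))"
  proof (rule sum.reindex_bij_witness[of _ "\<lambda>k. (k div n, k mod n)" "\<lambda>(i, j). i * n + j"])
    fix a assume a: "a \<in> {..<m} \<times> {..<n}"
    then obtain i j where ij: "a = (i, j)" "i < m" "j < n" by auto
    have "i * n + j < Suc i * n" using ij by simp
    also have "\<dots> \<le> m * n" using ij by (intro mult_right_mono) auto
    finally show "(case a of (i, j) \<Rightarrow> i * n + j) \<in> {..<m * n}" using ij by simp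
  qed (auto dest: div_mod_less_mult)
  finally show ?thesis by simp
qed

text \<open>The mixed-product rule: the sum over the composite index factors into sums over its two
  components.\<close>

lemma kron_mult:
  fixes A B C D :: "complex mat"
  assumes "A \<in> carrier_mat m n" "C \<in> carrier_mat n k"
    and "B \<in> carrier_mat m' n'" "D \<in> carrier_mat n' k'"
  shows "kron A B * kron C D = kron (A * C) (B * D)"
proof (intro eq_matI)
  fix i j assume "i < dim_row (kron (A * C) (B * D))" "j < dim_col (kron (A * C) (B * D))"
  then have ij: "i < m * m'" "j < k * k'" using assms by auto
  note b = div_mod_less_mult[OF ij(1)] div_mod_less_mult[OF ij(2)]
  have "(kron A B * kron C D) $$ (i, j) =
      (\<Sum>l<n * n'. (A $$ (i div m', l div n') * C $$ (l div n', j div k')) *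
                   (B $$ (i mod m', l mod n') * D $$ (l mod n', j mod k')))"
    using assms ij by (auto simp: scalar_prod_def kron_index lessThan_atLeast0 intro!: sum.cong)
  also have "\<dots> = (\<Sum>p<n. \<Sum>q<n'. (A $$ (i div m', p) * C $$ (p, j div k')) *
                   (B $$ (i mod m', q) * D $$ (q, j mod k')))"
    by (rule sum_div_mod)
  also have "\<dots> = (\<Sum>p<n. A $$ (i div m', p) * C $$ (p, j div k')) *
                   (\<Sum>q<n'. B $$ (i mod m', q) * D $$ (q, j mod k'))"
    by (simp add: sum_product)
  also have "\<dots> = kron (A * C) (B * D) $$ (i, j)"
    using assms ij b by (auto simp: scalar_prod_def kron_index lessThan_atLeast0)
  finally show "(kron A B * kron C D) $$ (i, j) = kron (A * C) (B * D) $$ (i, j)" .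
qed (use assms in auto)

lemma kron_adjoint: "mat_adjoint (kron A B) = kron (mat_adjoint A) (mat_adjoint B)"
  for A B :: "complex mat"
proof (intro eq_matI)
  fix i j assume "i < dim_row (kron (mat_adjoint A) (mat_adjoint B))"
    "j < dim_col (kron (mat_adjoint A) (mat_adjoint B))"
  then have ij: "i < dim_col A * dim_col B" "j < dim_row A * dim_row B" by auto
  show "mat_adjoint (kron A B) $$ (i, j) = kron (mat_adjoint A) (mat_adjoint B) $$ (i, j)"
    using ij div_mod_less_mult[OF ij(1)] div_mod_less_mult[OF ij(2)] by (simp add: kron_index)
qed auto

lemma kron_one: "kron (1\<^sub>m m) (1\<^sub>m n) = 1\<^sub>m (m * n)"
proof (intro eq_matI)
  fix i j assume "i < dim_row (1\<^sub>m (m * n) :: complex mat)" "j < dim_col (1\<^sub>m (m * n) :: complex mat)"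
  then have ij: "i < m * n" "j < m * n" by auto
  have "(i div n = j div n \<and> i mod n = j mod n) = (i = j)"
    by (metis div_mult_mod_eq)
  then show "kron (1\<^sub>m m) (1\<^sub>m n) $$ (i, j) = 1\<^sub>m (m * n) $$ (i, j)"
    using ij div_mod_less_mult[OF ij(1)] div_mod_less_mult[OF ij(2)] by (auto simp: kron_index)
qed auto

lemma kron_isometry:
  fixes V W :: "complex mat"
  assumes "V \<in> carrier_mat m n" "W \<in> carrier_mat m' n'"
    and "mat_adjoint V * V = 1\<^sub>m n" "mat_adjoint W * W = 1\<^sub>m n'"
  shows "mat_adjoint (kron V W) * kron V W = 1\<^sub>m (n * n')"
  using assms kron_mult[of "mat_adjoint V" n m V n "mat_adjoint W" n' m' W n']
  by (simp add: kron_adjoint kron_one)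

text \<open>Taking the adjoint reverses the product and cyclicity of the trace restores it, so the
  trace equals its conjugate. Hence measured values are real and passing to \<open>Re\<close> loses
  nothing.\<close>

lemma Im_trace_mult_hermitian:
  assumes "hermitian_op d A" "hermitian_op d B"
  shows "Im (trace (A * B)) = 0"
proof -
  have c: "A \<in> carrier_mat d d" "B \<in> carrier_mat d d" using assms hermitian_op_carrier by auto
  have adj: "trace (mat_adjoint M) = cnj (trace M)" if "M \<in> carrier_mat d d" for M
    using that by (auto simp: trace_def)
  have "cnj (trace (A * B)) = trace (mat_adjoint (A * B))" using c by (intro adj[symmetric]) simp
  also have "mat_adjoint (A * B) = B * A"
    using c assms by (simp add: mat_adjoint_mult[of _ d d _ d] hermitian_op_def)
  also have "trace (B * A) = trace (A * B)" using c by (intro trace_mult_comm) auto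
  finally show ?thesis by (simp add: complex_eq_iff)
qed

lemma hermitian_kron:
  "hermitian_op m A \<Longrightarrow> hermitian_op n B \<Longrightarrow> hermitian_op (m * n) (kron A B)"
  by (auto simp: hermitian_op_def kron_adjoint)

section \<open>Direct sums of measurements\<close>

definition inj_left :: "nat \<Rightarrow> nat \<Rightarrow> complex mat" where
  "inj_left m n = mat (m + n) m (\<lambda>(i, j). if i = j then 1 else 0)"

definition inj_right :: "nat \<Rightarrow> nat \<Rightarrow> complex mat" where
  "inj_right m n = mat (m + n) n (\<lambda>(i, j). if i = m + j then 1 else 0)"

text \<open>Written with congruences along the two inclusions instead of as a block matrix, so that
  positivity and compression follow from the congruence lemmas.\<close>

definition direct_sum :: "complex mat \<Rightarrow> complex mat \<Rightarrow> complex mat" where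
  "direct_sum A B = inj_left (dim_row A) (dim_row B) * A * mat_adjoint (inj_left (dim_row A) (dim_row B))
    + inj_right (dim_row A) (dim_row B) * B * mat_adjoint (inj_right (dim_row A) (dim_row B))"

lemma inj_carrier [simp]:
  "inj_left m n \<in> carrier_mat (m + n) m" "inj_right m n \<in> carrier_mat (m + n) n"
  by (auto simp: inj_left_def inj_right_def)

lemma inj_dim [simp]:
  "dim_row (inj_left m n) = m + n" "dim_col (inj_left m n) = m"
  "dim_row (inj_right m n) = m + n" "dim_col (inj_right m n) = n"
  by (auto simp: inj_left_def inj_right_def)

lemma inj_orthonormal:
  "mat_adjoint (inj_left m n) * inj_left m n = 1\<^sub>m m"
  "mat_adjoint (inj_right m n) * inj_right m n = 1\<^sub>m n"
  "mat_adjoint (inj_left m n) * inj_right m n = 0\<^sub>m m n"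
  "mat_adjoint (inj_right m n) * inj_left m n = 0\<^sub>m n m"
  by (intro eq_matI; simp add: inj_left_def inj_right_def scalar_prod_def
      if_distrib[of cnj] if_distrib[of "\<lambda>x. x * _"] sum.If_cases cong: if_cong; fail)+

lemma direct_sum_one: "direct_sum (1\<^sub>m m) (1\<^sub>m n) = 1\<^sub>m (m + n)"
proof (intro eq_matI)
  fix i j assume "i < dim_row (1\<^sub>m (m + n) :: complex mat)" "j < dim_col (1\<^sub>m (m + n) :: complex mat)"
  then have ij: "i < m + n" "j < m + n" by auto
  have L: "(inj_left m n * mat_adjoint (inj_left m n)) $$ (i, j) =
      (\<Sum>k<m. if i = k \<and> j = k then 1 else 0)"
    using ij by (auto simp: inj_left_def scalar_prod_def lessThan_atLeast0 intro!: sum.cong)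
  have R: "(inj_right m n * mat_adjoint (inj_right m n)) $$ (i, j) =
      (\<Sum>k<n. if i = m + k \<and> j = m + k then 1 else 0)"
    using ij by (auto simp: inj_right_def scalar_prod_def lessThan_atLeast0 intro!: sum.cong)
  have "(\<Sum>k<m. if i = k \<and> j = k then 1 else 0 :: complex) = (if i = j \<and> i < m then 1 else 0)"
    by (cases "i = j") (auto intro!: sum.neutral)
  \<comment> \<open>If \<open>i < m\<close>, the truncated difference \<open>i - m\<close> is 0; the
    guard \<open>m \<le> i\<close> then keeps the term at zero.\<close>
  moreover have "(\<Sum>k<n. if i = m + k \<and> j = m + k then 1 else 0 :: complex) =
      (\<Sum>k<n. if k = i - m then if i = j \<and> m \<le> i then 1 else 0 else 0)"
    by (intro sum.cong) auto
  ultimately show "direct_sum (1\<^sub>m m) (1\<^sub>m n) $$ (i, j) = 1\<^sub>m (m + n) $$ (i, j)"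
    using ij L R
    by (auto simp: direct_sum_def right_mult_one_mat[of _ "m + n"] simp del: index_mult_mat(1))
qed (auto simp: direct_sum_def)

lemma direct_sum_carrier:
  assumes "A \<in> carrier_mat m m" "B \<in> carrier_mat n n"
  shows "direct_sum A B \<in> carrier_mat (m + n) (m + n)"
  using assms unfolding direct_sum_def by (intro add_carrier_mat mult_carrier_mat[of _ _ n]) auto

lemma psd_direct_sum:
  assumes "psd_op m A" "psd_op n B"
  shows "psd_op (m + n) (direct_sum A B)"
  using psd_congruence[OF assms(1), of "inj_left m n"] psd_congruence[OF assms(2), of "inj_right m n"]
    psd_op_carrier[OF assms(1)] psd_op_carrier[OF assms(2)]
  by (simp add: direct_sum_def psd_add)

lemma congruence_add:
  fixes A B U :: "complex mat"
  assumes "A \<in> carrier_mat n n" "B \<in> carrier_mat n n" "U \<in> carrier_mat m n"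
  shows "U * (A + B) * mat_adjoint U = U * A * mat_adjoint U + U * B * mat_adjoint U"
proof -
  have "U * (A + B) = U * A + U * B" using assms by (intro mult_add_distrib_mat) auto
  moreover have "(U * A + U * B) * mat_adjoint U = U * A * mat_adjoint U + U * B * mat_adjoint U"
    using assms by (intro add_mult_distrib_mat[of _ m n]) auto
  ultimately show ?thesis by simp
qed

text \<open>The \<open>A\<close> summand is recovered because the inclusion is an isometry; the
  \<open>B\<close> summand vanishes because the ranges of the two inclusions are orthogonal.\<close>

lemma direct_sum_compress_left:
  assumes A: "A \<in> carrier_mat m m" and B: "B \<in> carrier_mat n n"
  shows "mat_adjoint (inj_left m n) * direct_sum A B * inj_left m n = A"
proof -
  let ?L = "inj_left m n" and ?R = "inj_right m n"
  have "mat_adjoint ?L * direct_sum A B * ?L =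
      mat_adjoint ?L * (?L * A * mat_adjoint ?L) * ?L + mat_adjoint ?L * (?R * B * mat_adjoint ?R) * ?L"
    using congruence_add[of "?L * A * mat_adjoint ?L" "m + n" "?R * B * mat_adjoint ?R" "mat_adjoint ?L" m] A B
    by (simp add: direct_sum_def mult_carrier_mat[of _ "m + n" m _ "m + n"]
        mult_carrier_mat[of _ "m + n" m _ m] mult_carrier_mat[of _ "m + n" n _ "m + n"]
        mult_carrier_mat[of _ "m + n" n _ n])
  also have "mat_adjoint ?L * (?L * A * mat_adjoint ?L) * ?L = A"
    using A by (intro congruence_cancel) (auto simp: inj_orthonormal)
  also have "mat_adjoint ?L * (?R * B * mat_adjoint ?R) * ?L = 0\<^sub>m m m"
    using congruence_compose[of B n ?R "m + n" "mat_adjoint ?L" m] B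
    by (simp add: inj_orthonormal)
  finally show ?thesis using A by simp
qed

lemma direct_sum_compress_right:
  assumes A: "A \<in> carrier_mat m m" and B: "B \<in> carrier_mat n n"
  shows "mat_adjoint (inj_right m n) * direct_sum A B * inj_right m n = B"
proof -
  let ?L = "inj_left m n" and ?R = "inj_right m n"
  have "mat_adjoint ?R * direct_sum A B * ?R =
      mat_adjoint ?R * (?L * A * mat_adjoint ?L) * ?R + mat_adjoint ?R * (?R * B * mat_adjoint ?R) * ?R"
    using congruence_add[of "?L * A * mat_adjoint ?L" "m + n" "?R * B * mat_adjoint ?R" "mat_adjoint ?R" n] A B
    by (simp add: direct_sum_def mult_carrier_mat[of _ "m + n" m _ "m + n"]
        mult_carrier_mat[of _ "m + n" m _ m] mult_carrier_mat[of _ "m + n" n _ "m + n"]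
        mult_carrier_mat[of _ "m + n" n _ n])
  also have "mat_adjoint ?R * (?R * B * mat_adjoint ?R) * ?R = B"
    using B by (intro congruence_cancel) (auto simp: inj_orthonormal)
  also have "mat_adjoint ?R * (?L * A * mat_adjoint ?L) * ?R = 0\<^sub>m n n"
    using congruence_compose[of A m ?L "m + n" "mat_adjoint ?R" n] A
    by (simp add: inj_orthonormal)
  finally show ?thesis using B by simp
qed

section \<open>Measurements and states under block embeddings\<close>

definition outcome_sum :: "nat \<Rightarrow> ('a :: finite \<Rightarrow> complex mat) \<Rightarrow> complex mat" where
  "outcome_sum d F = mat d d (\<lambda>ij. \<Sum>a\<in>UNIV. F a $$ ij)"

lemma outcome_sum_carrier [simp]: "outcome_sum d F \<in> carrier_mat d d"
  by (simp add: outcome_sum_def)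

text \<open>A congruence is linear in its middle factor; entrywise it is a finite double sum, which
  is exchanged with the sum over outcomes.\<close>

lemma congruence_outcome_sum:
  assumes F: "\<And>a. F a \<in> carrier_mat n n" and V: "V \<in> carrier_mat m n"
  shows "outcome_sum m (\<lambda>a. V * F a * mat_adjoint V) = V * outcome_sum n F * mat_adjoint V"
proof (intro eq_matI)
  fix i j assume "i < dim_row (V * outcome_sum n F * mat_adjoint V)"
    "j < dim_col (V * outcome_sum n F * mat_adjoint V)"
  then have ij: "i < m" "j < m" using V by auto
  have entry: "(V * G * mat_adjoint V) $$ (i, j) = (\<Sum>l<n. \<Sum>k<n. V $$ (i, k) * G $$ (k, l) * cnj (V $$ (j, l)))"
    if "G \<in> carrier_mat n n" for G
    using that V ij by (auto simp: scalar_prod_def lessThan_atLeast0 sum_distrib_right intro!: sum.cong)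
  have "outcome_sum m (\<lambda>a. V * F a * mat_adjoint V) $$ (i, j) =
      (\<Sum>a\<in>UNIV. \<Sum>l<n. \<Sum>k<n. V $$ (i, k) * F a $$ (k, l) * cnj (V $$ (j, l)))"
    using ij by (simp add: outcome_sum_def entry[OF F])
  also have "\<dots> = (\<Sum>l<n. \<Sum>k<n. \<Sum>a\<in>UNIV. V $$ (i, k) * F a $$ (k, l) * cnj (V $$ (j, l)))"
    by (subst sum.swap, intro sum.cong refl, rule sum.swap)
  also have "\<dots> = (\<Sum>l<n. \<Sum>k<n. V $$ (i, k) * outcome_sum n F $$ (k, l) * cnj (V $$ (j, l)))"
    by (simp add: outcome_sum_def sum_distrib_left sum_distrib_right)
  also have "\<dots> = (V * outcome_sum n F * mat_adjoint V) $$ (i, j)"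
    by (rule entry[symmetric]) simp
  finally show "outcome_sum m (\<lambda>a. V * F a * mat_adjoint V) $$ (i, j) =
      (V * outcome_sum n F * mat_adjoint V) $$ (i, j)" .
qed (use V in \<open>auto simp: outcome_sum_def\<close>)

text \<open>The sum over outcomes passes into each block, where it is the identity.\<close>

lemma povm_direct_sum:
  assumes M: "povm m M" and N: "povm n N"
  shows "povm (m + n) (\<lambda>a x. direct_sum (M a x) (N a x))"
proof -
  have c: "M a x \<in> carrier_mat m m" "N a x \<in> carrier_mat n n" for a x
    using M N by (auto simp: povm_def psd_op_carrier)
  have "outcome_sum (m + n) (\<lambda>a. direct_sum (M a x) (N a x)) = 1\<^sub>m (m + n)" for x
  proof -
    have "outcome_sum (m + n) (\<lambda>a. direct_sum (M a x) (N a x)) =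
        outcome_sum (m + n) (\<lambda>a. inj_left m n * M a x * mat_adjoint (inj_left m n)) +
        outcome_sum (m + n) (\<lambda>a. inj_right m n * N a x * mat_adjoint (inj_right m n))"
      using c[THEN carrier_matD(1)]
      by (intro eq_matI)
        (simp_all add: outcome_sum_def direct_sum_def sum.distrib inj_left_def inj_right_def
          del: index_mult_mat(1))
    also have "\<dots> = inj_left m n * outcome_sum m (\<lambda>a. M a x) * mat_adjoint (inj_left m n) +
        inj_right m n * outcome_sum n (\<lambda>a. N a x) * mat_adjoint (inj_right m n)"
      using c congruence_outcome_sum[of "\<lambda>a. M a x" m "inj_left m n" "m + n"]
        congruence_outcome_sum[of "\<lambda>a. N a x" n "inj_right m n" "m + n"] by simp
    also have "\<dots> = direct_sum (1\<^sub>m m) (1\<^sub>m n)"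
      using M N by (simp add: povm_def outcome_sum_def direct_sum_def)
    finally show ?thesis by (simp add: direct_sum_one)
  qed
  then show ?thesis
    using M N by (simp add: povm_def psd_direct_sum flip: outcome_sum_def)
qed

text \<open>Cyclicity of the trace moves the local maps from the state to the measurement: measuring
  an embedded state amounts to measuring the original one with compressed operators.\<close>

lemma trace_kron_congruence:
  fixes M N V W \<rho> :: "complex mat"
  assumes M: "M \<in> carrier_mat m m" and N: "N \<in> carrier_mat n n"
    and V: "V \<in> carrier_mat m k" and W: "W \<in> carrier_mat n l" and \<rho>: "\<rho> \<in> carrier_mat (k * l) (k * l)"
  shows "trace (kron M N * (kron V W * \<rho> * mat_adjoint (kron V W))) =
    trace (kron (mat_adjoint V * M * V) (mat_adjoint W * N * W) * \<rho>)"
proof -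
  let ?K = "kron M N" and ?V = "kron V W"
  have K: "?K \<in> carrier_mat (m * n) (m * n)" and Vc: "?V \<in> carrier_mat (m * n) (k * l)"
    using M N V W by auto
  have "trace (?K * (?V * \<rho> * mat_adjoint ?V)) = trace (?K * (?V * \<rho>) * mat_adjoint ?V)"
    using K Vc \<rho> by (subst assoc_mult_mat[of ?K "m * n" "m * n" "?V * \<rho>" "k * l" _ "m * n"]) auto
  also have "\<dots> = trace (mat_adjoint ?V * (?K * (?V * \<rho>)))"
    using K Vc \<rho> by (intro trace_mult_comm[of _ "m * n" "k * l"]) auto
  also have "?K * (?V * \<rho>) = ?K * ?V * \<rho>"
    using K Vc \<rho> by (intro assoc_mult_mat[symmetric]) auto
  also have "mat_adjoint ?V * (?K * ?V * \<rho>) = mat_adjoint ?V * (?K * ?V) * \<rho>"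
    using K Vc \<rho> by (intro assoc_mult_mat[symmetric, of _ "k * l" "m * n" _ "k * l"]) auto
  also have "mat_adjoint ?V * (?K * ?V) = mat_adjoint ?V * ?K * ?V"
    using K Vc by (intro assoc_mult_mat[symmetric, of _ "k * l" "m * n" _ "m * n" _ "k * l"]) auto
  also have "mat_adjoint ?V * ?K = kron (mat_adjoint V * M) (mat_adjoint W * N)"
    unfolding kron_adjoint using M N V W by (intro kron_mult) auto
  also have "\<dots> * ?V = kron (mat_adjoint V * M * V) (mat_adjoint W * N * W)"
    using M N V W by (intro kron_mult[of _ k m _ k _ l n _ l]) auto
  finally show ?thesis .
qed

lemma density_congruence:
  assumes "density_op n \<rho>" "V \<in> carrier_mat m n" "mat_adjoint V * V = 1\<^sub>m n"
  shows "density_op m (V * \<rho> * mat_adjoint V)"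
  using assms trace_congruence[of \<rho> n V m] psd_congruence[of n \<rho> V m]
  by (simp add: density_op_def psd_op_carrier)

lemma trace_mult_real_combination:
  assumes "K \<in> carrier_mat d d" "A \<in> carrier_mat d d" "B \<in> carrier_mat d d"
  shows "trace (K * (a \<cdot>\<^sub>m A + b \<cdot>\<^sub>m B)) = a * trace (K * A) + b * trace (K * B)"
proof -
  have "K * (a \<cdot>\<^sub>m A + b \<cdot>\<^sub>m B) = a \<cdot>\<^sub>m (K * A) + b \<cdot>\<^sub>m (K * B)"
    using assms by (simp add: mult_add_distrib_mat[of _ d d _ d] mult_smult_distrib[of _ d d _ d])
  then show ?thesis
    using assms by (simp add: trace_add[of _ d] trace_smult[of _ d])
qed

section \<open>Feasible weights for boxes and for operators\<close>

text \<open>The counterpart of \<open>robust_feasible\<close> for the set whose infimum is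
  \<open>rob_Q\<close>.\<close>

definition box_feasible :: "('a::finite, 'b::finite, 'x::finite, 'y::finite) box \<Rightarrow> real \<Rightarrow> bool" where
  "box_feasible p t \<longleftrightarrow> 0 \<le> t \<and> (\<exists>w \<in> quantum_boxes. box_mix p t w \<in> quantum_boxes)"

text \<open>Measure \<open>\<sigma>\<close> and the mixture with the POVMs that realize
  \<open>p\<close> on \<open>Om\<close>. The trace is linear in the operator, so the boxes mix with
  the same weight \<open>t\<close>.\<close>

lemma feasible_box_of_operator:
  assumes O: "pseudo_state dA dB Om" and p: "realizes dA dB Om p" and t: "robust_feasible (dA * dB) Om t"
  shows "box_feasible p t"
proof -
  obtain M N where M: "povm dA M" and N: "povm dB N"
    and tr: "\<And>a b x y. complex_of_real (p a b x y) = trace (kron (M a x) (N b y) * Om)"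
    using p by (auto simp: realizes_def)
  obtain \<sigma> where t0: "0 \<le> t" and \<sigma>: "density_op (dA * dB) \<sigma>"
    and \<rho>: "density_op (dA * dB) ((1 / (1 + complex_of_real t)) \<cdot>\<^sub>m (Om + complex_of_real t \<cdot>\<^sub>m \<sigma>))"
    using t by (auto simp: robust_feasible_def)
  have hM: "hermitian_op dA (M a x)" and hN: "hermitian_op dB (N b y)" for a b x y
    using M N by (auto simp: povm_def psd_op_def)
  have K: "kron (M a x) (N b y) \<in> carrier_mat (dA * dB) (dA * dB)" for a b x y
    using hermitian_op_carrier[OF hM] hermitian_op_carrier[OF hN] by simp
  have Oc: "Om \<in> carrier_mat (dA * dB) (dA * dB)" using O by (simp add: pseudo_state_def hermitian_op_def)
  have \<sigma>c: "\<sigma> \<in> carrier_mat (dA * dB) (dA * dB)" using \<sigma> by (simp add: density_op_def psd_op_carrier)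
  define w where "w = (\<lambda>a b x y. Re (trace (kron (M a x) (N b y) * \<sigma>)))"
  have w: "complex_of_real (w a b x y) = trace (kron (M a x) (N b y) * \<sigma>)" for a b x y
    using Im_trace_mult_hermitian[OF hermitian_kron[OF hM hN], of \<sigma>] \<sigma>
    by (simp add: w_def complex_eq_iff density_op_def psd_op_hermitian)
  have "w \<in> quantum_boxes"
    using \<sigma> M N w unfolding quantum_boxes_def realizes_def by blast
  moreover have "complex_of_real (box_mix p t w a b x y) = trace (kron (M a x) (N b y) *
      ((1 / (1 + complex_of_real t)) \<cdot>\<^sub>m (Om + complex_of_real t \<cdot>\<^sub>m \<sigma>)))" for a b x y
  proof -
    \<comment> \<open>The factor \<open>1\<close> in front of \<open>Om\<close> brings the sum into
      the form of \<open>trace_mult_real_combination\<close>.\<close>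
    have "trace (kron (M a x) (N b y) * ((1 / (1 + complex_of_real t)) \<cdot>\<^sub>m (Om + complex_of_real t \<cdot>\<^sub>m \<sigma>))) =
        (1 / (1 + complex_of_real t)) * trace (kron (M a x) (N b y) * (1 \<cdot>\<^sub>m Om + complex_of_real t \<cdot>\<^sub>m \<sigma>))"
      using K[of a x b y] Oc \<sigma>c
      by (simp add: mult_smult_distrib[of _ "dA * dB" "dA * dB" _ "dA * dB"] trace_smult[of _ "dA * dB"])
    then show ?thesis
      unfolding trace_mult_real_combination[OF K Oc \<sigma>c] by (simp add: box_mix_def tr w)
  qed
  then have "box_mix p t w \<in> quantum_boxes"
    using \<rho> M N unfolding quantum_boxes_def realizes_def by blast
  ultimately show ?thesis using t0 by (auto simp: box_feasible_def)
qed

text \<open>The two quantum realizations may differ in dimensions and in measurements. Orthogonal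
  local blocks let one pair of block-diagonal POVMs act as the first realization on
  \<open>\<sigma>1\<close> and as the second on \<open>\<sigma>2\<close>, so the affine combination
  \<open>Om\<close> realizes \<open>p\<close>. The weight \<open>t\<close> is feasible because
  adding \<open>t\<close> times \<open>\<sigma>2\<close> to \<open>Om\<close> leaves
  \<open>1 + t\<close> times \<open>\<sigma>1\<close>.\<close>

lemma feasible_operator_of_box:
  assumes "box_feasible p t"
  obtains dA dB Om where "pseudo_state dA dB Om" "realizes dA dB Om p" "robust_feasible (dA * dB) Om t"
proof -
  obtain w where t0: "0 \<le> t" and w: "w \<in> quantum_boxes" "box_mix p t w \<in> quantum_boxes"
    using assms by (auto simp: box_feasible_def)
  obtain a1 b1 \<rho>1 M1 N1 where \<rho>1: "density_op (a1 * b1) \<rho>1" and M1: "povm a1 M1" and N1: "povm b1 N1"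
    and tr1: "\<And>a b x y. complex_of_real (box_mix p t w a b x y) = trace (kron (M1 a x) (N1 b y) * \<rho>1)"
    using w(2) unfolding quantum_boxes_def realizes_def by blast
  obtain a2 b2 \<rho>2 M2 N2 where \<rho>2: "density_op (a2 * b2) \<rho>2" and M2: "povm a2 M2" and N2: "povm b2 N2"
    and tr2: "\<And>a b x y. complex_of_real (w a b x y) = trace (kron (M2 a x) (N2 b y) * \<rho>2)"
    using w(1) unfolding quantum_boxes_def realizes_def by blast
  define dA where "dA = a1 + a2"
  define dB where "dB = b1 + b2"
  define d where "d = dA * dB"
  \<comment> \<open>The first state goes to the left-left block and the second to the right-right
    block; the two mixed blocks of the product space stay empty.\<close>
  define V1 where "V1 = kron (inj_left a1 a2) (inj_left b1 b2)"
  define V2 where "V2 = kron (inj_right a1 a2) (inj_right b1 b2)"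
  have V: "V1 \<in> carrier_mat d (a1 * b1)" "V2 \<in> carrier_mat d (a2 * b2)"
    by (auto simp: V1_def V2_def d_def dA_def dB_def)
  have VV: "mat_adjoint V1 * V1 = 1\<^sub>m (a1 * b1)" "mat_adjoint V2 * V2 = 1\<^sub>m (a2 * b2)"
    unfolding V1_def V2_def
    by (rule kron_isometry[OF inj_carrier(1) inj_carrier(1)], simp_all add: inj_orthonormal)
      (rule kron_isometry[OF inj_carrier(2) inj_carrier(2)], simp_all add: inj_orthonormal)
  define \<sigma>1 where "\<sigma>1 = V1 * \<rho>1 * mat_adjoint V1"
  define \<sigma>2 where "\<sigma>2 = V2 * \<rho>2 * mat_adjoint V2"
  have \<sigma>: "density_op d \<sigma>1" "density_op d \<sigma>2"
    using \<rho>1 \<rho>2 V VV by (auto simp: \<sigma>1_def \<sigma>2_def intro!: density_congruence)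
  have \<sigma>c: "\<sigma>1 \<in> carrier_mat d d" "\<sigma>2 \<in> carrier_mat d d"
    using \<sigma> by (auto simp: density_op_def psd_op_carrier)
  define Om where "Om = complex_of_real (1 + t) \<cdot>\<^sub>m \<sigma>1 + complex_of_real (- t) \<cdot>\<^sub>m \<sigma>2"
  have "hermitian_op d Om"
    unfolding Om_def using \<sigma> by (intro hermitian_add hermitian_smult) (auto simp: density_op_def psd_op_def)
  moreover have "trace Om = 1"
    using \<sigma> \<sigma>c by (simp add: Om_def trace_add[of _ d] trace_smult[of _ d] density_op_def)
  ultimately have O: "pseudo_state dA dB Om" by (simp add: pseudo_state_def d_def)
  define M where "M = (\<lambda>a x. direct_sum (M1 a x) (M2 a x))"
  define N where "N = (\<lambda>b y. direct_sum (N1 b y) (N2 b y))"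
  have MN: "povm dA M" "povm dB N"
    using M1 M2 N1 N2 by (auto simp: M_def N_def dA_def dB_def povm_direct_sum)
  have c: "M1 a x \<in> carrier_mat a1 a1" "M2 a x \<in> carrier_mat a2 a2"
    "N1 b y \<in> carrier_mat b1 b1" "N2 b y \<in> carrier_mat b2 b2" for a b x y
    using M1 M2 N1 N2 by (auto simp: povm_def psd_op_carrier)
  have rc: "\<rho>1 \<in> carrier_mat (a1 * b1) (a1 * b1)" "\<rho>2 \<in> carrier_mat (a2 * b2) (a2 * b2)"
    using \<rho>1 \<rho>2 by (auto simp: density_op_def psd_op_carrier)
  have MNc: "M a x \<in> carrier_mat dA dA" "N b y \<in> carrier_mat dB dB" for a b x y
    using c by (auto simp: M_def N_def dA_def dB_def direct_sum_carrier)
  have "complex_of_real (p a b x y) = trace (kron (M a x) (N b y) * Om)" for a b x y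
  proof -
    have "trace (kron (M a x) (N b y) * \<sigma>1) = complex_of_real (box_mix p t w a b x y)"
      unfolding \<sigma>1_def V1_def
      using trace_kron_congruence[OF MNc(1)[of a x, unfolded dA_def] MNc(2)[of b y, unfolded dB_def]
         inj_carrier(1) inj_carrier(1) rc(1)] c
      by (simp add: M_def N_def direct_sum_compress_left tr1)
    moreover have "trace (kron (M a x) (N b y) * \<sigma>2) = complex_of_real (w a b x y)"
      unfolding \<sigma>2_def V2_def
      using trace_kron_congruence[OF MNc(1)[of a x, unfolded dA_def] MNc(2)[of b y, unfolded dB_def]
         inj_carrier(2) inj_carrier(2) rc(2)] c
      by (simp add: M_def N_def direct_sum_compress_right tr2)
    ultimately have "trace (kron (M a x) (N b y) * Om) =
        complex_of_real ((1 + t) * box_mix p t w a b x y + - t * w a b x y)"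
      unfolding Om_def using MNc \<sigma>c by (subst trace_mult_real_combination[of _ d]) (auto simp: d_def)
    \<comment> \<open>The definition of \<open>box_mix\<close> solved for \<open>p\<close>; the
      division is sound since \<open>0 \<le> t\<close>.\<close>
    also have "(1 + t) * box_mix p t w a b x y + - t * w a b x y = p a b x y"
      using t0 by (simp add: box_mix_def)
    finally show ?thesis by simp
  qed
  then have "realizes dA dB Om p" using MN by (auto simp: realizes_def)
  moreover have "robust_feasible d Om t"
  proof -
    have "1 / (1 + complex_of_real t) * complex_of_real (1 + t) = 1"
      using t0 by (simp add: complex_eq_iff)
    moreover have "Om + complex_of_real t \<cdot>\<^sub>m \<sigma>2 = complex_of_real (1 + t) \<cdot>\<^sub>m \<sigma>1"
      using \<sigma>c by (intro eq_matI) (auto simp: Om_def)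
    ultimately have "(1 / (1 + complex_of_real t)) \<cdot>\<^sub>m (Om + complex_of_real t \<cdot>\<^sub>m \<sigma>2) = \<sigma>1"
      by (simp only: smult_smult_mat smult_one_mat)
    then show ?thesis using \<sigma> t0 by (auto simp: robust_feasible_def)
  qed
  ultimately show ?thesis using O that by (simp add: d_def)
qed

section \<open>Equality of the four infima\<close>

theorem theorem1:
  fixes p :: "('a::finite, 'b::finite, 'x::finite, 'y::finite) box"
  assumes "no_signalling p"
  shows "rob_D_box p = rob_Q p \<and>
         rob_Q p = Inf {Inf {trace_dist (dA * dB) Om \<rho> | \<rho>. density_op (dA * dB) \<rho>} | dA dB Om.
                          pseudo_state dA dB Om \<and> realizes dA dB Om p} \<and>
         Inf {Inf {trace_dist (dA * dB) Om \<rho> | \<rho>. density_op (dA * dB) \<rho>} | dA dB Om.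
                 pseudo_state dA dB Om \<and> realizes dA dB Om p}
         = Inf {(trace_norm (dA * dB) Om - 1) / 2 | dA dB Om. pseudo_state dA dB Om \<and> realizes dA dB Om p}"
proof -
  \<comment> \<open>On each pseudo-state separately, robustness and distance to the density
    operators equal the value collected in \<open>R\<close>, so three of the four infima range over
    this one set.\<close>
  define R where "R = {(trace_norm (dA * dB) Om - 1) / 2 | dA dB Om.
    pseudo_state dA dB Om \<and> realizes dA dB Om p}"
  have "(u = rob_D_op (dA * dB) Om \<and> pseudo_state dA dB Om \<and> realizes dA dB Om p) \<longleftrightarrow>
      (u = (trace_norm (dA * dB) Om - 1) / 2 \<and> pseudo_state dA dB Om \<and> realizes dA dB Om p)"
    for u dA dB Om
    by (auto simp: pseudo_state_def rob_D_op_eq)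
  then have D: "{rob_D_op (dA * dB) Om | dA dB Om. pseudo_state dA dB Om \<and> realizes dA dB Om p} = R"
    unfolding R_def by (simp only:)
  have "(u = Inf {trace_dist (dA * dB) Om \<rho> | \<rho>. density_op (dA * dB) \<rho>} \<and>
        pseudo_state dA dB Om \<and> realizes dA dB Om p) \<longleftrightarrow>
      (u = (trace_norm (dA * dB) Om - 1) / 2 \<and> pseudo_state dA dB Om \<and> realizes dA dB Om p)"
    for u dA dB Om
    by (auto simp: pseudo_state_def Inf_trace_dist_eq)
  then have T: "{Inf {trace_dist (dA * dB) Om \<rho> | \<rho>. density_op (dA * dB) \<rho>} | dA dB Om.
      pseudo_state dA dB Om \<and> realizes dA dB Om p} = R"
    unfolding R_def by (simp only:)
  \<comment> \<open>Each value in \<open>R\<close> is attained as a robustness, hence feasible for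
    the box.\<close>
  have sub: "R \<subseteq> Collect (box_feasible p)"
  proof
    fix t assume "t \<in> R"
    then obtain dA dB Om where 1: "t = (trace_norm (dA * dB) Om - 1) / 2" "pseudo_state dA dB Om"
      "realizes dA dB Om p"
      by (auto simp: R_def)
    have "robust_feasible (dA * dB) Om t"
      unfolding 1(1) using 1(2) by (intro robust_feasible_attained) (auto simp: pseudo_state_def)
    then show "t \<in> Collect (box_feasible p)" using feasible_box_of_operator 1 by blast
  qed
  \<comment> \<open>The converse holds only up to an inequality: a feasible \<open>t\<close> yields
    an operator whose own value may be smaller than \<open>t\<close>. Equality of the infima needs
    no more.\<close>
  have below: "\<exists>s\<in>R. s \<le> t" if t: "box_feasible p t" for t
  proof -
    obtain dA dB Om where 1: "pseudo_state dA dB Om" "realizes dA dB Om p" "robust_feasible (dA * dB) Om t"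
      using feasible_operator_of_box[OF t] .
    then have "(trace_norm (dA * dB) Om - 1) / 2 \<le> t"
      by (intro robust_feasible_ge) (auto simp: pseudo_state_def)
    moreover have "(trace_norm (dA * dB) Om - 1) / 2 \<in> R" using 1 unfolding R_def by blast
    ultimately show ?thesis by blast
  qed
  have "Inf R = Inf (Collect (box_feasible p))"
  proof (cases "R = {}")
    \<comment> \<open>Here both sides are the junk value \<open>Inf {}\<close>.\<close>
    case True
    then have "Collect (box_feasible p) = {}" using below by blast
    then show ?thesis using True by (simp only:)
  next
    case False
    have bdd: "bdd_below (Collect (box_feasible p))"
      by (intro bdd_belowI[of _ 0]) (auto simp: box_feasible_def)
    show ?thesis
    proof (rule antisym)
      show "Inf R \<le> Inf (Collect (box_feasible p))"
        using False sub below bdd_below_mono[OF bdd sub]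
        by (intro cInf_mono) auto
      show "Inf (Collect (box_feasible p)) \<le> Inf R"
        using False sub bdd by (intro cInf_superset_mono)
    qed
  qed
  then have "rob_Q p = Inf R" by (simp only: rob_Q_def box_feasible_def[abs_def])
  then show ?thesis unfolding rob_D_box_def D T R_def[symmetric] by simp
qed

end
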